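(* We have $$\limsup_{d\to\infty}\sqrt[d]{\mathrm{BH}_{[-1,1]}^{=d}}=2$$ and $$\limsup_{d\to\infty}\sqrt[d]{\mathrm{BH}_{[-1,1]}^{\le d}}=1+\sqrt2 .$$
   Context: For $d\in\mathbb{N}=\{1,2,\dots\}$, $\mathrm{BH}_{[-1,1]}^{\le d}$ denotes the best (smallest) constant $C\ge1$ such that for every $n\in\mathbb{N}$ and every polynomial $P(x)=\sum_{\alpha\in\mathbb{N}_0^n,\,|\alpha|\le d}a_\alpha x^\alpha$ in $n$ real variables with real coefficients $a_\alpha$, $$\Big(\sum_{\alpha\in\mathbb{N}_0^n,\,|\alpha|\le d}|a_\alpha|^{\frac{2d}{d+1}}\Big)^{\frac{d+1}{2d}}\le C\,\sup_{x\in[-1,1]^n}|P(x)|.$$ Analogously, $\mathrm{BH}_{[-1,1]}^{=d}$ denotes the best constant $C\ge 1$ such that the same inequality holds for every $n\in\mathbb{N}$ and every $d$-homogeneous polynomial $P(x)=\sum_{\alpha\in\mathbb{N}_0^n,\,|\alpha|=d}a_\alpha x^\alpha$ with real coefficients (the sum on the left then running over $|\alpha|=d$). Here $|\alpha|=\alpha_1+\dots+\alpha_n$ and $x^\alpha=x_1^{\alpha_1}\cdots x_n^{\alpha_n}$. *)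

theory Defs
  imports "HOL-Analysis.Analysis"
begin

(* A multi-index in N_0^n is a function on nat vanishing at all positions i >= n, and a polynomial
   in n variables is given by its coefficients on a finite set of multi-indices. *)

definition multi_indices :: "nat \<Rightarrow> (nat \<Rightarrow> nat) set" where
  "multi_indices n = {\<alpha>. \<forall>i\<ge>n. \<alpha> i = 0}"

definition mdegree :: "nat \<Rightarrow> (nat \<Rightarrow> nat) \<Rightarrow> nat" where
  "mdegree n \<alpha> = (\<Sum>i<n. \<alpha> i)"

definition indices_le :: "nat \<Rightarrow> nat \<Rightarrow> (nat \<Rightarrow> nat) set" where
  "indices_le d n = {\<alpha> \<in> multi_indices n. mdegree n \<alpha> \<le> d}"

definition indices_eq :: "nat \<Rightarrow> nat \<Rightarrow> (nat \<Rightarrow> nat) set" where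
  "indices_eq d n = {\<alpha> \<in> multi_indices n. mdegree n \<alpha> = d}"

definition mpoly_eval ::
    "nat \<Rightarrow> (nat \<Rightarrow> nat) set \<Rightarrow> ((nat \<Rightarrow> nat) \<Rightarrow> real) \<Rightarrow> (nat \<Rightarrow> real) \<Rightarrow> real" where
  "mpoly_eval n \<Lambda> a x = (\<Sum>\<alpha>\<in>\<Lambda>. a \<alpha> * (\<Prod>i<n. x i ^ \<alpha> i))"

definition cube :: "nat \<Rightarrow> (nat \<Rightarrow> real) set" where
  "cube n = ({..<n} \<rightarrow>\<^sub>E {-1..1})"

definition BH_inequality :: "nat \<Rightarrow> (nat \<Rightarrow> (nat \<Rightarrow> nat) set) \<Rightarrow> real \<Rightarrow> bool" where
  "BH_inequality d \<Lambda> C \<longleftrightarrow>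
     (\<forall>n\<ge>1. \<forall>a :: (nat \<Rightarrow> nat) \<Rightarrow> real.
        (\<Sum>\<alpha>\<in>\<Lambda> n. \<bar>a \<alpha>\<bar> powr (2 * real d / (real d + 1))) powr ((real d + 1) / (2 * real d))
          \<le> C * (SUP x\<in>cube n. \<bar>mpoly_eval n (\<Lambda> n) a x\<bar>))"

(* The constants are extended reals, so that the value is \<infinity> should no C be admissible; the
   infimum of the (closed) set of admissible C is otherwise attained. *)

definition BH_le :: "nat \<Rightarrow> ereal" where
  "BH_le d = Inf {ereal C | C. C \<ge> 1 \<and> BH_inequality d (indices_le d) C}"

definition BH_hom :: "nat \<Rightarrow> ereal" where
  "BH_hom d = Inf {ereal C | C. C \<ge> 1 \<and> BH_inequality d (indices_eq d) C}"

definition ereal_root :: "nat \<Rightarrow> ereal \<Rightarrow> ereal" where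
  "ereal_root d x = (if x = \<infinity> then \<infinity> else ereal (root d (real_of_ereal x)))"

end

theory Submission
  imports Defs "HOL-Complex_Analysis.Complex_Analysis"
begin

text \<open>
  Upper bounds: a real polynomial of degree at most \<open>d\<close> bounded by \<open>1\<close> on the real cube is bounded by
  \<open>2 ^ d\<close> (homogeneous case) or \<open>(1 + sqrt 2) ^ d\<close> (general case) on the complex polydisc, so it suffices
  that the Bohnenblust--Hille constants of the polydisc grow subexponentially. To see this, split
  \<open>d\<close> into blocks of sizes \<open>k t\<close> between \<open>k\<close> and \<open>2 k\<close> and each multi-index accordingly. Blei's inequality
  reduces the claim to mixed norms, with \<open>\<ell>\<^sub>2\<close> outside a block. These \<open>\<ell>\<^sub>2\<close>-norms are \<open>L\<^sub>2\<close>-norms of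
  Taylor coefficients of order \<open>k t\<close>, which by hypercontractivity are at most \<open>2 ^ (d / k t)\<close> times
  \<open>L\<^sub>r\<close>-norms with \<open>r = 2 k t / (k t + 1)\<close>; the remaining sum is controlled by the inequality for the
  fixed degree \<open>k t\<close>, which in turn follows from the same argument with blocks of size \<open>1\<close>. Hence the
  \<open>d\<close>-th root of the constant has limes superior at most \<open>2 powr (1 / k)\<close> for every \<open>k\<close>.

  Lower bounds: Chebyshev polynomials evaluated at the imaginary unit in the general case, and in the
  homogeneous case high powers of the forms \<open>Q\<close> obtained by iterating \<open>Q(x)\<^sup>2 - Q(y)\<^sup>2\<close> from \<open>Q(x) = x\<close>: they are
  bounded by \<open>1\<close> on the real cube, but attain \<open>2 ^ (deg Q - 1)\<close> on the torus.
\<close>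

section \<open>Blei's inequality\<close>

text \<open>Jensen's inequality for \<open>exp\<close>. The geometric mean stays in logarithmic
  form, which is how Blei's inequality computes it.\<close>

lemma weighted_arith_geom_mean:
  fixes w x :: "'a \<Rightarrow> real"
  assumes "finite S" "\<And>i. i \<in> S \<Longrightarrow> w i \<ge> 0" "sum w S = 1" "\<And>i. i \<in> S \<Longrightarrow> x i > 0"
  shows "exp (\<Sum>i\<in>S. w i * ln (x i)) \<le> (\<Sum>i\<in>S. w i * x i)"
proof -
  have "S \<noteq> {}" using assms(3) by auto
  then have "exp (\<Sum>i\<in>S. w i *\<^sub>R ln (x i)) \<le> (\<Sum>i\<in>S. w i * exp (ln (x i)))"
    by (intro convex_on_sum[where C = UNIV] exp_convex assms) auto
  then show ?thesis using assms(4) by simp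
qed

text \<open>Each \<alpha> is regarded as the tuple of its coordinates
  \<open>\<pi> t \<alpha>\<close>. After division by the right-hand side, the summand at \<alpha> is
  a weighted geometric mean of quantities whose sums over \<open>A\<close> are at most 1, so the
  arithmetic-geometric mean inequality finishes the proof without iterated Hoelder or Minkowski
  inequalities.\<close>

lemma Blei_inequality:
  fixes c :: "'a \<Rightarrow> real" and \<pi> :: "'t \<Rightarrow> 'a \<Rightarrow> 'b" and k :: "'t \<Rightarrow> nat"
  assumes fin: "finite A" "finite T" and ne: "T \<noteq> {}"
    and c: "\<And>\<alpha>. \<alpha> \<in> A \<Longrightarrow> c \<alpha> > 0"
    and inj: "\<And>\<alpha> \<beta>. \<alpha> \<in> A \<Longrightarrow> \<beta> \<in> A \<Longrightarrow> (\<And>t. t \<in> T \<Longrightarrow> \<pi> t \<alpha> = \<pi> t \<beta>) \<Longrightarrow> \<alpha> = \<beta>"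
    and m: "m = sum k T"
  shows "(\<Sum>\<alpha>\<in>A. c \<alpha> powr (2 * real m / (real m + 1)))
    \<le> (\<Prod>t\<in>T. (\<Sum>x\<in>\<pi> t ` A. (\<Sum>\<alpha>\<in>{\<alpha>\<in>A. \<pi> t \<alpha> = x}. (c \<alpha>)\<^sup>2) powr (real (k t) / (real (k t) + 1)))
                powr ((real (k t) + 1) / (real m + 1)))"
proof (cases "A = {}")
  case True
  then show ?thesis by (auto intro: prod_nonneg)
next
  case False
  define F where "F t x = (\<Sum>\<alpha>\<in>{\<alpha>\<in>A. \<pi> t \<alpha> = x}. (c \<alpha>)\<^sup>2)" for t x
  define G where "G t x = F t x powr (real (k t) / (real (k t) + 1))" for t x
  define N where "N t = (\<Sum>x\<in>\<pi> t ` A. G t x)" for t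
  define K where "K = (\<Prod>t\<in>T. N t powr ((real (k t) + 1) / (real m + 1)))"
  have Fpos: "F t x > 0" if "x \<in> \<pi> t ` A" for t x
    unfolding F_def using that fin by (intro sum_pos) (auto dest: c)
  then have Gpos: "G t x > 0" if "x \<in> \<pi> t ` A" for t x
    using that unfolding G_def by fastforce
  have Npos: "N t > 0" for t
    unfolding N_def using False fin by (intro sum_pos Gpos) auto
  have GN: "G t (\<pi> t \<alpha>) / N t > 0" if "\<alpha> \<in> A" for t \<alpha>
    using Gpos[of "\<pi> t \<alpha>" t] Npos[of t] that by simp
  have Kpos: "K > 0"
    unfolding K_def by (intro prod_pos) (use Npos in \<open>auto simp: less_le\<close>)
  have sumk: "(\<Sum>t\<in>T. real (k t) / (real m + 1)) = real m / (real m + 1)"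
    unfolding m of_nat_sum sum_divide_distrib ..
  then have weights: "(\<Sum>t\<in>T. real (k t) / (real m + 1)) + 1 / (real m + 1) = 1"
    by (simp flip: add_divide_distrib)
  \<comment> \<open>The power of \<open>F\<close> is chosen so that summing over a fibre of
    \<open>\<pi> t\<close> gives \<open>G t x / N t\<close>; hence \<open>y t\<close> has total mass
    1 on \<open>A\<close>.\<close>
  define y where "y t \<alpha> = (c \<alpha>)\<^sup>2 * F t (\<pi> t \<alpha>) powr (- 1 / (real (k t) + 1)) / N t" for t \<alpha>
  \<comment> \<open>A product of the probability weights \<open>G t x / N t\<close> on the separate
    coordinates.\<close>
  define z where "z \<alpha> = (\<Prod>t\<in>T. G t (\<pi> t \<alpha>) / N t)" for \<alpha>
  have ypos: "y t \<alpha> > 0" if "\<alpha> \<in> A" for t \<alpha>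
    unfolding y_def using that Fpos[of "\<pi> t \<alpha>" t] Npos[of t] c[of \<alpha>] by auto
  have zpos: "z \<alpha> > 0" if "\<alpha> \<in> A" for \<alpha>
    unfolding z_def using GN[OF that] by (intro prod_pos)
  have pointwise: "c \<alpha> powr (2 * real m / (real m + 1)) / K
      \<le> (\<Sum>t\<in>T. real (k t) / (real m + 1) * y t \<alpha>) + 1 / (real m + 1) * z \<alpha>" if \<alpha>: "\<alpha> \<in> A" for \<alpha>
  proof -
    \<comment> \<open>The index \<open>None\<close> carries the extra weight 1/(m+1) of
      \<open>z\<close>, and the indices \<open>Some t\<close> carry the weights of the
      \<open>y t\<close>.\<close>
    define w where "w = (\<lambda>j. case j of None \<Rightarrow> 1 / (real m + 1) | Some t \<Rightarrow> real (k t) / (real m + 1))"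
    define v where "v = (\<lambda>j. case j of None \<Rightarrow> z \<alpha> | Some t \<Rightarrow> y t \<alpha>)"
    define S where "S = insert None (Some ` T)"
    have sumS: "(\<Sum>j\<in>S. h j) = (\<Sum>t\<in>T. h (Some t)) + h None" for h :: "'t option \<Rightarrow> real"
      unfolding S_def using fin by (subst sum.insert) (auto simp: sum.reindex)
    have "exp (\<Sum>j\<in>S. w j * ln (v j)) \<le> (\<Sum>j\<in>S. w j * v j)"
    proof (rule weighted_arith_geom_mean)
      show "finite S" using fin by (simp add: S_def)
      show "sum w S = 1" using weights by (simp add: sumS w_def)
    qed (auto simp: w_def v_def S_def ypos zpos \<alpha>)
    also have "(\<Sum>j\<in>S. w j * ln (v j)) = ln (c \<alpha> powr (2 * real m / (real m + 1)) / K)"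
    proof -
      have lny: "ln (y t \<alpha>) = 2 * ln (c \<alpha>) - ln (F t (\<pi> t \<alpha>)) / (real (k t) + 1) - ln (N t)" for t
        unfolding y_def using c[OF \<alpha>] Fpos[of "\<pi> t \<alpha>" t] Npos[of t] \<alpha>
        by (simp add: ln_div ln_mult ln_powr ln_realpow)
      have lnz: "ln (z \<alpha>) = (\<Sum>t\<in>T. real (k t) / (real (k t) + 1) * ln (F t (\<pi> t \<alpha>)) - ln (N t))"
      proof -
        have "ln (z \<alpha>) = (\<Sum>t\<in>T. ln (G t (\<pi> t \<alpha>) / N t))"
          unfolding z_def using GN[OF \<alpha>] fin by (intro ln_prod) (metis less_irrefl)+
        also have "\<dots> = (\<Sum>t\<in>T. real (k t) / (real (k t) + 1) * ln (F t (\<pi> t \<alpha>)) - ln (N t))"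
        proof (intro sum.cong refl)
          fix t
          show "ln (G t (\<pi> t \<alpha>) / N t) = real (k t) / (real (k t) + 1) * ln (F t (\<pi> t \<alpha>)) - ln (N t)"
            using Gpos[of "\<pi> t \<alpha>" t] Npos[of t] Fpos[of "\<pi> t \<alpha>" t] \<alpha>
            by (simp add: ln_div) (simp add: G_def ln_powr)
        qed
        finally show ?thesis .
      qed
      have lnK: "ln K = (\<Sum>t\<in>T. (real (k t) + 1) / (real m + 1) * ln (N t))"
      proof -
        have "ln K = (\<Sum>t\<in>T. ln (N t powr ((real (k t) + 1) / (real m + 1))))"
          unfolding K_def using fin Npos by (intro ln_prod) (auto simp: less_le)
        then show ?thesis using Npos by (simp add: ln_powr)
      qed
      have "(\<Sum>j\<in>S. w j * ln (v j)) =
          (\<Sum>t\<in>T. real (k t) / (real m + 1) * ln (y t \<alpha>)) + 1 / (real m + 1) * ln (z \<alpha>)"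
        by (simp add: sumS w_def v_def)
      \<comment> \<open>The logarithms of \<open>F\<close> coming from \<open>y\<close> and from
        \<open>z\<close> cancel, while those of \<open>N\<close> add up to exponent (k t + 1)/(m +
        1), as in \<open>K\<close>.\<close>
      also have "\<dots> = (\<Sum>t\<in>T. real (k t) / (real m + 1) * (2 * ln (c \<alpha>)) - (real (k t) + 1) / (real m + 1) * ln (N t))"
        unfolding lny lnz sum_distrib_left sum.distrib[symmetric]
      proof (intro sum.cong refl)
        fix t
        show "real (k t) / (real m + 1) * (2 * ln (c \<alpha>) - ln (F t (\<pi> t \<alpha>)) / (real (k t) + 1) - ln (N t)) +
            1 / (real m + 1) * (real (k t) / (real (k t) + 1) * ln (F t (\<pi> t \<alpha>)) - ln (N t)) =
            real (k t) / (real m + 1) * (2 * ln (c \<alpha>)) - (real (k t) + 1) / (real m + 1) * ln (N t)"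
          by (simp add: algebra_simps add_divide_distrib diff_divide_distrib)
      qed
      also have "\<dots> = 2 * real m / (real m + 1) * ln (c \<alpha>) - ln K"
        unfolding lnK sum_subtractf sum_distrib_right[symmetric] sumk by simp
      also have "\<dots> = ln (c \<alpha> powr (2 * real m / (real m + 1)) / K)"
        using c[OF \<alpha>] Kpos by (simp add: ln_div ln_powr)
      finally show ?thesis .
    qed
    also have "exp (ln (c \<alpha> powr (2 * real m / (real m + 1)) / K)) = c \<alpha> powr (2 * real m / (real m + 1)) / K"
      using c[OF \<alpha>] Kpos by (intro exp_ln) auto
    also have "(\<Sum>j\<in>S. w j * v j) = (\<Sum>t\<in>T. real (k t) / (real m + 1) * y t \<alpha>) + 1 / (real m + 1) * z \<alpha>"
      by (simp add: sumS w_def v_def)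
    finally show ?thesis .
  qed
  have sumy: "(\<Sum>\<alpha>\<in>A. y t \<alpha>) = 1" for t
  proof -
    have "(\<Sum>\<alpha>\<in>A. y t \<alpha>) = (\<Sum>x\<in>\<pi> t ` A. \<Sum>\<alpha>\<in>{\<alpha>\<in>A. \<pi> t \<alpha> = x}. y t \<alpha>)"
      using fin(1) by (rule sum.image_gen)
    also have "\<dots> = (\<Sum>x\<in>\<pi> t ` A. G t x / N t)"
    proof (intro sum.cong refl)
      fix x assume x: "x \<in> \<pi> t ` A"
      have "(\<Sum>\<alpha>\<in>{\<alpha>\<in>A. \<pi> t \<alpha> = x}. y t \<alpha>)
          = F t x * F t x powr (- 1 / (real (k t) + 1)) / N t"
        unfolding y_def F_def[of t x] sum_distrib_right sum_divide_distrib
        by (intro sum.cong refl) (auto simp: F_def)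
      also have "F t x * F t x powr (- 1 / (real (k t) + 1)) = F t x powr (1 + (- 1 / (real (k t) + 1)))"
        using Fpos[OF x] by (simp only: powr_add powr_one)
      also have "1 + (- 1 / (real (k t) + 1)) = real (k t) / (real (k t) + 1)"
        by (simp add: field_simps)
      finally show "(\<Sum>\<alpha>\<in>{\<alpha>\<in>A. \<pi> t \<alpha> = x}. y t \<alpha>) = G t x / N t"
        by (simp add: G_def)
    qed
    also have "\<dots> = 1"
      using Npos[of t] by (simp add: N_def flip: sum_divide_distrib)
    finally show ?thesis .
  qed
  have sumz: "(\<Sum>\<alpha>\<in>A. z \<alpha>) \<le> 1"
  proof -
    define \<Phi> where "\<Phi> = (\<lambda>\<alpha>. restrict (\<lambda>t. \<pi> t \<alpha>) T)"
    have "inj_on \<Phi> A"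
    proof (rule inj_onI)
      fix \<alpha> \<beta> assume *: "\<alpha> \<in> A" "\<beta> \<in> A" "\<Phi> \<alpha> = \<Phi> \<beta>"
      show "\<alpha> = \<beta>"
      proof (rule inj[OF *(1,2)])
        fix t assume "t \<in> T"
        then show "\<pi> t \<alpha> = \<pi> t \<beta>" using fun_cong[OF *(3), of t] by (simp add: \<Phi>_def)
      qed
    qed
    then have "(\<Sum>\<alpha>\<in>A. z \<alpha>) = (\<Sum>g\<in>\<Phi> ` A. \<Prod>t\<in>T. G t (g t) / N t)"
      by (subst sum.reindex) (auto simp: z_def \<Phi>_def intro!: sum.cong prod.cong)
    \<comment> \<open>By injectivity \<open>A\<close> embeds into the product of its coordinate
      projections; over the full product the sum factorizes into total masses.\<close>
    also have "\<dots> \<le> (\<Sum>g\<in>PiE T (\<lambda>t. \<pi> t ` A). \<Prod>t\<in>T. G t (g t) / N t)"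
    proof (rule sum_mono2)
      show "finite (PiE T (\<lambda>t. \<pi> t ` A))" using fin by (intro finite_PiE) auto
      show "\<Phi> ` A \<subseteq> PiE T (\<lambda>t. \<pi> t ` A)" by (auto simp: \<Phi>_def)
      show "0 \<le> (\<Prod>t\<in>T. G t (g t) / N t)" for g
        by (intro prod_nonneg) (use Npos in \<open>auto simp: G_def less_imp_le\<close>)
    qed
    also have "\<dots> = (\<Prod>t\<in>T. \<Sum>x\<in>\<pi> t ` A. G t x / N t)"
      using fin by (intro prod_sum_PiE[symmetric]) auto
    also have "\<dots> = (\<Prod>t\<in>T. 1)"
    proof (intro prod.cong refl)
      fix t
      show "(\<Sum>x\<in>\<pi> t ` A. G t x / N t) = 1"
        using Npos[of t] by (simp add: N_def flip: sum_divide_distrib)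
    qed
    finally show ?thesis by simp
  qed
  have "(\<Sum>\<alpha>\<in>A. c \<alpha> powr (2 * real m / (real m + 1)) / K)
      \<le> (\<Sum>\<alpha>\<in>A. (\<Sum>t\<in>T. real (k t) / (real m + 1) * y t \<alpha>) + 1 / (real m + 1) * z \<alpha>)"
    by (intro sum_mono pointwise)
  also have "\<dots> = (\<Sum>t\<in>T. real (k t) / (real m + 1) * (\<Sum>\<alpha>\<in>A. y t \<alpha>)) + 1 / (real m + 1) * (\<Sum>\<alpha>\<in>A. z \<alpha>)"
    unfolding sum.distrib sum_distrib_left by (subst sum.swap) simp
  also have "\<dots> \<le> (\<Sum>t\<in>T. real (k t) / (real m + 1)) + 1 / (real m + 1) * 1"
    unfolding sumy by (intro add_mono mult_left_mono sumz) auto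
  also have "\<dots> = 1"
    using weights by simp
  finally have "(\<Sum>\<alpha>\<in>A. c \<alpha> powr (2 * real m / (real m + 1))) \<le> K"
    using Kpos by (simp add: field_simps flip: sum_divide_distrib)
  then show ?thesis unfolding K_def N_def G_def F_def .
qed

section \<open>Averages over roots of unity\<close>

definition cpoly :: "nat \<Rightarrow> (nat \<Rightarrow> nat) set \<Rightarrow> ((nat \<Rightarrow> nat) \<Rightarrow> complex) \<Rightarrow> (nat \<Rightarrow> complex) \<Rightarrow> complex"
  where "cpoly n \<Lambda> c z = (\<Sum>\<alpha>\<in>\<Lambda>. c \<alpha> * (\<Prod>i<n. z i ^ \<alpha> i))"

definition madd :: "(nat \<Rightarrow> nat) \<Rightarrow> (nat \<Rightarrow> nat) \<Rightarrow> nat \<Rightarrow> nat"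
  where "madd \<alpha> \<beta> = (\<lambda>i. \<alpha> i + \<beta> i)"

definition below :: "nat \<Rightarrow> (nat \<Rightarrow> nat) \<Rightarrow> (nat \<Rightarrow> nat) set"
  where "below n f = {\<gamma> \<in> multi_indices n. \<forall>i<n. \<gamma> i \<le> f i}"

lemma multi_indices_eqI:
  assumes "\<alpha> \<in> multi_indices n" "\<beta> \<in> multi_indices n" "\<And>i. i < n \<Longrightarrow> \<alpha> i = \<beta> i"
  shows "\<alpha> = \<beta>"
proof
  fix i show "\<alpha> i = \<beta> i"
    using assms by (cases "i < n") (auto simp: multi_indices_def)
qed

lemma prod_sum_below:
  fixes g :: "nat \<Rightarrow> nat \<Rightarrow> 'a::comm_semiring_1"
  shows "(\<Prod>i<n. \<Sum>j\<le>f i. g i j) = (\<Sum>\<gamma>\<in>below n f. \<Prod>i<n. g i (\<gamma> i))"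
proof -
  have "(\<Prod>i<n. \<Sum>j\<le>f i. g i j) = (\<Sum>h\<in>PiE {..<n} (\<lambda>i. {..f i}). \<Prod>i<n. g i (h i))"
    by (intro prod_sum_PiE) auto
  also have "\<dots> = (\<Sum>\<gamma>\<in>below n f. \<Prod>i<n. g i (\<gamma> i))"
    \<comment> \<open>The bijection only changes the default value at indices from n on: undefined
      for \<open>PiE\<close>, 0 for multi-indices.\<close>
    by (rule sum.reindex_bij_witness[where j = "\<lambda>h i. if i < n then h i else 0"
          and i = "\<lambda>\<gamma>. restrict \<gamma> {..<n}"])
      (auto simp: below_def multi_indices_def PiE_iff extensional_def fun_eq_iff)
  finally show ?thesis .
qed

lemma card_below: "card (below n f) = (\<Prod>i<n. f i + 1)"
  using prod_sum_below[of "\<lambda>_ _. 1 :: nat" f n] by simp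

text \<open>The cardinality just computed is positive, whereas \<open>card\<close> of an infinite
  set is 0.\<close>

lemma finite_below: "finite (below n f)"
  by (rule card_ge_0_finite) (simp add: card_below)

lemma indices_le_subset_below: "indices_le d n \<subseteq> below n (\<lambda>_. d)"
proof
  fix \<alpha> assume \<alpha>: "\<alpha> \<in> indices_le d n"
  have "\<alpha> i \<le> d" if "i < n" for i
    using member_le_sum[of i "{..<n}" \<alpha>] that \<alpha> by (auto simp: indices_le_def mdegree_def)
  then show "\<alpha> \<in> below n (\<lambda>_. d)" using \<alpha> by (auto simp: below_def indices_le_def)
qed

lemma indices_eq_subset_le: "indices_eq d n \<subseteq> indices_le d n"
  by (auto simp: indices_le_def indices_eq_def)

lemma finite_indices_le: "finite (indices_le d n)"
  using indices_le_subset_below finite_below by (rule finite_subset)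

lemma finite_indices_eq: "finite (indices_eq d n)"
  using indices_eq_subset_le finite_indices_le by (rule finite_subset)

text \<open>A crude count, but polynomial in d for fixed n, so its d-th root tends to 1. This is all
  that the lower bounds need.\<close>

lemma card_indices_le: "card (indices_le d n) \<le> (d + 1) ^ n"
  using card_mono[OF finite_below indices_le_subset_below, of d n] by (simp add: card_below)

lemma card_indices_eq: "card (indices_eq d n) \<le> (d + 1) ^ n"
  using card_mono[OF finite_indices_le indices_eq_subset_le, of d n] card_indices_le[of d n] by simp

lemma madd_in_indices_eq:
  "\<alpha> \<in> indices_eq a n \<Longrightarrow> \<beta> \<in> indices_eq b n \<Longrightarrow> madd \<alpha> \<beta> \<in> indices_eq (a + b) n"
  by (auto simp: indices_eq_def multi_indices_def mdegree_def madd_def sum.distrib)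

section \<open>Orthogonality of monomials on roots of unity\<close>

lemma norm_root_unity:
  fixes z :: complex
  assumes "z ^ N = 1" "N > 0"
  shows "norm z = 1"
  using power_eq_imp_eq_base[of "norm z" N 1] assms by (simp flip: norm_power)

text \<open>Multiplication by a primitive root \<omega> permutes the roots and multiplies the sum by
  \<open>\<omega> ^ j\<close>, which differs from 1.\<close>

lemma sum_power_roots_unity:
  assumes "0 < j" "j < N"
  shows "(\<Sum>z\<in>{z::complex. z ^ N = 1}. z ^ j) = 0"
proof -
  define \<omega> where "\<omega> = cis (2 * pi * real 1 / real N)"
  have N: "0 < N" using assms by simp
  have \<omega>N: "\<omega> ^ N = 1" using Complex.bij_betw_roots_unity[OF N] assms
    by (auto simp: \<omega>_def bij_betw_def Complex.DeMoivre)
  have "\<omega> ^ j \<noteq> 1"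
  proof
    assume "\<omega> ^ j = 1"
    then have "cis (2 * pi * real j / real N) = cis (2 * pi * real 0 / real N)"
      by (simp add: \<omega>_def Complex.DeMoivre mult_ac)
    then show False
      using Complex.bij_betw_roots_unity[OF N] assms unfolding bij_betw_def
      by (auto dest: inj_onD[where x = j and y = 0])
  qed
  have "\<omega> \<noteq> 0" by (simp add: \<omega>_def)
  let ?S = "\<Sum>z\<in>{z::complex. z ^ N = 1}. z ^ j"
  have "?S = (\<Sum>z\<in>{z::complex. z ^ N = 1}. (\<omega> * z) ^ j)"
    by (rule sum.reindex_bij_witness[where i = "\<lambda>z. \<omega> * z" and j = "\<lambda>z. z / \<omega>"])
      (use \<omega>N \<open>\<omega> \<noteq> 0\<close> in \<open>auto simp: power_mult_distrib power_divide\<close>)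
  also have "\<dots> = \<omega> ^ j * ?S" by (simp add: power_mult_distrib sum_distrib_left)
  finally show ?thesis using \<open>\<omega> ^ j \<noteq> 1\<close> by auto
qed

text \<open>Conjugation inverts a root of unity, so each summand is a power with exponent the
  difference of a and b, or its conjugate. Exponents below N exclude aliasing.\<close>

lemma sum_roots_unity_orthogonal:
  assumes "a < N" "b < N"
  shows "(\<Sum>z\<in>{z::complex. z ^ N = 1}. z ^ a * cnj (z ^ b)) = (if a = b then of_nat N else 0)"
proof -
  have zc: "z * cnj z = 1" if "z ^ N = 1" for z :: complex
    using norm_root_unity[OF that] assms by (simp add: complex_norm_square[symmetric])
  show ?thesis
  proof (cases a b rule: linorder_cases)
    case less
    have eq: "z ^ a * cnj (z ^ b) = cnj (z ^ (b - a))" if "z ^ N = 1" for z :: complex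
    proof -
      have "z ^ a * cnj (z ^ b) = (z * cnj z) ^ a * cnj (z ^ (b - a))"
        using less by (simp add: power_mult_distrib flip: power_add)
      then show ?thesis using zc[OF that] by simp
    qed
    have "(\<Sum>z\<in>{z::complex. z ^ N = 1}. z ^ a * cnj (z ^ b)) = cnj (\<Sum>z\<in>{z::complex. z ^ N = 1}. z ^ (b - a))"
      unfolding cnj_sum by (intro sum.cong refl) (auto simp: eq simp del: complex_cnj_power)
    then show ?thesis using less assms by (subst (asm) sum_power_roots_unity) auto
  next
    case equal
    have "(\<Sum>z\<in>{z::complex. z ^ N = 1}. z ^ a * cnj (z ^ b)) = (\<Sum>z\<in>{z::complex. z ^ N = 1}. 1)"
      by (intro sum.cong refl) (use zc equal in \<open>auto simp flip: power_mult_distrib\<close>)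
    then show ?thesis using card_roots_unity_eq[of N] assms equal by simp
  next
    case greater
    have eq: "z ^ a * cnj (z ^ b) = z ^ (a - b)" if "z ^ N = 1" for z :: complex
    proof -
      have "z ^ a * cnj (z ^ b) = (z * cnj z) ^ b * z ^ (a - b)"
        using greater by (simp add: power_mult_distrib flip: power_add)
      then show ?thesis using zc[OF that] by simp
    qed
    have "(\<Sum>z\<in>{z::complex. z ^ N = 1}. z ^ a * cnj (z ^ b)) = (\<Sum>z\<in>{z::complex. z ^ N = 1}. z ^ (a - b))"
      by (intro sum.cong refl) (auto simp: eq simp del: complex_cnj_power)
    then show ?thesis using greater assms by (subst (asm) sum_power_roots_unity) auto
  qed
qed

text \<open>A finite substitute for the torus: for polynomials with all exponents below N, the mean
  square over the grid equals the integral over the torus.\<close>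

definition roots_grid :: "nat \<Rightarrow> nat \<Rightarrow> (nat \<Rightarrow> complex) set"
  where "roots_grid N n = PiE {..<n} (\<lambda>_. {z. z ^ N = 1})"

lemma finite_roots_grid: "N > 0 \<Longrightarrow> finite (roots_grid N n)"
  unfolding roots_grid_def by (intro finite_PiE finite_roots_unity) auto

lemma card_roots_grid: "N > 0 \<Longrightarrow> card (roots_grid N n) = N ^ n"
  unfolding roots_grid_def by (subst card_PiE) (auto simp: card_roots_unity_eq)

lemma norm_roots_grid: "z \<in> roots_grid N n \<Longrightarrow> N > 0 \<Longrightarrow> i < n \<Longrightarrow> norm (z i) = 1"
  by (rule norm_root_unity[of _ N]) (auto simp: roots_grid_def)

lemma parseval_roots_grid:
  assumes A: "finite A" "A \<subseteq> multi_indices n" and N: "\<And>\<alpha> i. \<alpha> \<in> A \<Longrightarrow> i < n \<Longrightarrow> \<alpha> i < N"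
    and "N > 0"
  shows "(\<Sum>z\<in>roots_grid N n. (norm (cpoly n A c z))\<^sup>2) = real N ^ n * (\<Sum>\<alpha>\<in>A. (norm (c \<alpha>))\<^sup>2)"
proof -
  have orth: "(\<Sum>z\<in>roots_grid N n. \<Prod>i<n. z i ^ \<alpha> i * cnj (z i ^ \<beta> i)) = (if \<beta> = \<alpha> then of_nat N ^ n else 0)"
    if ab: "\<alpha> \<in> A" "\<beta> \<in> A" for \<alpha> \<beta>
  proof -
    have "(\<Sum>z\<in>roots_grid N n. \<Prod>i<n. z i ^ \<alpha> i * cnj (z i ^ \<beta> i))
        = (\<Prod>i<n. \<Sum>w\<in>{w::complex. w ^ N = 1}. w ^ \<alpha> i * cnj (w ^ \<beta> i))"
      unfolding roots_grid_def using \<open>N > 0\<close>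
      by (intro prod_sum_PiE[symmetric] finite_roots_unity) auto
    also have "\<dots> = (\<Prod>i<n. if \<alpha> i = \<beta> i then of_nat N else 0)"
    proof (rule prod.cong[OF refl])
      fix i assume "i \<in> {..<n}"
      then show "(\<Sum>w\<in>{w::complex. w ^ N = 1}. w ^ \<alpha> i * cnj (w ^ \<beta> i)) = (if \<alpha> i = \<beta> i then of_nat N else 0)"
        using N that by (intro sum_roots_unity_orthogonal) auto
    qed
    also have "\<dots> = (if \<beta> = \<alpha> then of_nat N ^ n else 0)"
    proof (cases "\<beta> = \<alpha>")
      case False
      then obtain i where i: "i < n" "\<alpha> i \<noteq> \<beta> i"
        using multi_indices_eqI[OF subsetD[OF A(2) ab(1)] subsetD[OF A(2) ab(2)]] by metis
      then have "(\<Prod>i<n. if \<alpha> i = \<beta> i then of_nat N else 0) = (0 :: complex)"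
        using i by (intro prod_zero) auto
      then show ?thesis using False by simp
    qed auto
    finally show ?thesis .
  qed
  have "complex_of_real (\<Sum>z\<in>roots_grid N n. (norm (cpoly n A c z))\<^sup>2)
      = (\<Sum>z\<in>roots_grid N n. \<Sum>\<alpha>\<in>A. \<Sum>\<beta>\<in>A. c \<alpha> * cnj (c \<beta>) * (\<Prod>i<n. z i ^ \<alpha> i * cnj (z i ^ \<beta> i)))"
    unfolding of_real_sum
    by (intro sum.cong refl)
      (simp add: complex_norm_square cpoly_def sum_product prod.distrib mult_ac del: of_real_power)
  also have "\<dots> = (\<Sum>\<alpha>\<in>A. \<Sum>\<beta>\<in>A. \<Sum>z\<in>roots_grid N n. c \<alpha> * cnj (c \<beta>) * (\<Prod>i<n. z i ^ \<alpha> i * cnj (z i ^ \<beta> i)))"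
    by (subst sum.swap, intro sum.cong refl, subst sum.swap) simp
  also have "\<dots> = (\<Sum>\<alpha>\<in>A. \<Sum>\<beta>\<in>A. if \<beta> = \<alpha> then c \<alpha> * cnj (c \<beta>) * of_nat N ^ n else 0)"
    unfolding sum_distrib_left[symmetric] by (intro sum.cong refl) (simp add: orth del: complex_cnj_power)
  also have "\<dots> = (\<Sum>\<alpha>\<in>A. c \<alpha> * cnj (c \<alpha>) * of_nat N ^ n)"
    using A by (intro sum.cong refl) (simp add: sum.delta)
  also have "\<dots> = complex_of_real (real N ^ n * (\<Sum>\<alpha>\<in>A. (norm (c \<alpha>))\<^sup>2))"
    by (simp add: sum_distrib_left complex_norm_square mult_ac del: of_real_power)
      (simp add: sum_distrib_left mult_ac)
  finally show ?thesis unfolding of_real_eq_iff .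
qed

section \<open>Fourth moments and hypercontractivity\<close>

text \<open>The coefficients of the product of two forms of degrees a and b. The coefficient type is
  left general so that real coefficients can be seen to stay real.\<close>

definition conv :: "nat \<Rightarrow> nat \<Rightarrow> nat \<Rightarrow> ((nat \<Rightarrow> nat) \<Rightarrow> 'a::comm_semiring_1) \<Rightarrow> ((nat \<Rightarrow> nat) \<Rightarrow> 'a) \<Rightarrow> (nat \<Rightarrow> nat) \<Rightarrow> 'a"
  where "conv n a b c d \<gamma> = (\<Sum>p\<in>{p \<in> indices_eq a n \<times> indices_eq b n. madd (fst p) (snd p) = \<gamma>}. c (fst p) * d (snd p))"

lemma cpoly_mult:
  "cpoly n (indices_eq a n) c z * cpoly n (indices_eq b n) d z = cpoly n (indices_eq (a + b) n) (conv n a b c d) z"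
proof -
  let ?S = "indices_eq a n \<times> indices_eq b n"
  let ?h = "\<lambda>p. c (fst p) * d (snd p) * (\<Prod>i<n. z i ^ madd (fst p) (snd p) i)"
  have "cpoly n (indices_eq a n) c z * cpoly n (indices_eq b n) d z = (\<Sum>p\<in>?S. ?h p)"
    unfolding cpoly_def sum_product sum.cartesian_product
    by (intro sum.cong refl) (auto simp: madd_def power_add prod.distrib mult_ac)
  also have "\<dots> = (\<Sum>\<gamma>\<in>indices_eq (a + b) n. \<Sum>p\<in>{p\<in>?S. madd (fst p) (snd p) = \<gamma>}. ?h p)"
    by (intro sum.group[symmetric] finite_cartesian_product finite_indices_eq)
      (auto intro: madd_in_indices_eq)
  also have "\<dots> = cpoly n (indices_eq (a + b) n) (conv n a b c d) z"
    unfolding cpoly_def conv_def sum_distrib_right by (intro sum.cong refl) auto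
  finally show ?thesis .
qed

text \<open>A decomposition is determined by its first summand, which lies in the box below
  \<gamma>; the box has at most \<Prod> 2^(\<gamma> i) = 2^(2j) elements, since t + 1 is at most
  2^t.\<close>

lemma card_decompositions:
  assumes \<gamma>: "\<gamma> \<in> indices_eq (2 * j) n"
  shows "card {p \<in> indices_eq j n \<times> indices_eq j n. madd (fst p) (snd p) = \<gamma>} \<le> 4 ^ j" (is "card ?S \<le> _")
proof -
  have "inj_on fst ?S"
    by (intro inj_onI prod_eqI) (auto simp: madd_def fun_eq_iff, metis add_left_cancel)
  moreover have "fst ` ?S \<subseteq> below n \<gamma>"
    by (auto simp: below_def indices_eq_def madd_def)
  ultimately have "card ?S \<le> card (below n \<gamma>)"
    using card_inj_on_le finite_below by blast
  also have "\<dots> = (\<Prod>i<n. \<gamma> i + 1)" by (rule card_below)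
  also have "\<dots> \<le> (\<Prod>i<n. 2 ^ \<gamma> i)"
    by (intro prod_mono) (auto simp: less_exp Suc_leI)
  also have "\<dots> = 4 ^ j"
    using \<gamma> by (simp add: indices_eq_def mdegree_def power_mult flip: power_sum)
  finally show ?thesis .
qed

text \<open>The fourth moment of a form is the second moment of its square. By Parseval it is a sum
  of squared convolution coefficients, and Cauchy-Schwarz costs the number of decompositions, at
  most 4^j.\<close>

lemma fourth_moment_bound:
  assumes N: "N > 2 * j"
  shows "(\<Sum>z\<in>roots_grid N n. (norm (cpoly n (indices_eq j n) c z)) ^ 4)
      \<le> real N ^ n * 4 ^ j * (\<Sum>\<alpha>\<in>indices_eq j n. (norm (c \<alpha>))\<^sup>2)\<^sup>2"
proof -
  let ?I = "indices_eq j n" and ?D = "\<lambda>\<gamma>. {p \<in> indices_eq j n \<times> indices_eq j n. madd (fst p) (snd p) = \<gamma>}"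
  let ?J = "indices_eq (j + j) n"
  have finD: "finite (?D \<gamma>)" for \<gamma>
    by (rule finite_subset[OF _ finite_cartesian_product[OF finite_indices_eq finite_indices_eq]]) auto
  \<comment> \<open>Parseval is applied to the square, of degree 2j, whence the assumption on
    N.\<close>
  have lt: "\<alpha> i < N" if "\<alpha> \<in> ?J" "i < n" for \<alpha> i
  proof -
    have "\<alpha> \<in> below n (\<lambda>_. j + j)" using that indices_eq_subset_le indices_le_subset_below by blast
    then have "\<alpha> i \<le> j + j" using that(2) unfolding below_def by blast
    then show ?thesis using N by simp
  qed
  have moment: "(\<Sum>z\<in>roots_grid N n. (norm (cpoly n ?I c z)) ^ 4)
      = real N ^ n * (\<Sum>\<gamma>\<in>?J. (norm (conv n j j c c \<gamma>))\<^sup>2)"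
  proof -
    have "(\<Sum>z\<in>roots_grid N n. (norm (cpoly n ?I c z)) ^ 4)
      = (\<Sum>z\<in>roots_grid N n. (norm (cpoly n ?J (conv n j j c c) z))\<^sup>2)"
    unfolding cpoly_mult[symmetric] norm_mult by (simp add: power4_eq_xxxx power2_eq_square mult_ac)
    also have "\<dots> = real N ^ n * (\<Sum>\<gamma>\<in>?J. (norm (conv n j j c c \<gamma>))\<^sup>2)"
      using lt N by (intro parseval_roots_grid finite_indices_eq) (auto simp: indices_eq_def)
    finally show ?thesis .
  qed
  have "(\<Sum>\<gamma>\<in>?J. (norm (conv n j j c c \<gamma>))\<^sup>2)
      \<le> (\<Sum>\<gamma>\<in>?J. 4 ^ j * (\<Sum>p\<in>?D \<gamma>. (norm (c (fst p)))\<^sup>2 * (norm (c (snd p)))\<^sup>2))"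
  proof (intro sum_mono)
    fix \<gamma> assume \<gamma>: "\<gamma> \<in> ?J"
    have "norm (conv n j j c c \<gamma>) \<le> (\<Sum>p\<in>?D \<gamma>. norm (c (fst p)) * norm (c (snd p)))"
      unfolding conv_def by (rule order_trans[OF norm_sum]) (simp add: norm_mult)
    then have "(norm (conv n j j c c \<gamma>))\<^sup>2 \<le> (\<Sum>p\<in>?D \<gamma>. norm (c (fst p)) * norm (c (snd p)))\<^sup>2"
      by (intro power_mono) auto
    also have "\<dots> \<le> real (card (?D \<gamma>)) * (\<Sum>p\<in>?D \<gamma>. (norm (c (fst p)) * norm (c (snd p)))\<^sup>2)"
      using sum_squared_le_sum_of_squares[of "\<lambda>p. norm (c (fst p)) * norm (c (snd p))" "?D \<gamma>"]
      by (simp add: mult.commute)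
    also have "\<dots> \<le> 4 ^ j * (\<Sum>p\<in>?D \<gamma>. (norm (c (fst p)) * norm (c (snd p)))\<^sup>2)"
    proof (intro mult_right_mono)
      have "card (?D \<gamma>) \<le> 4 ^ j"
        using \<gamma> by (intro card_decompositions) (simp add: mult_2)
      then have "real (card (?D \<gamma>)) \<le> real (4 ^ j)"
        by (rule of_nat_mono)
      then show "real (card (?D \<gamma>)) \<le> 4 ^ j" by simp
    qed (auto intro: sum_nonneg)
    finally show "(norm (conv n j j c c \<gamma>))\<^sup>2
        \<le> 4 ^ j * (\<Sum>p\<in>?D \<gamma>. (norm (c (fst p)))\<^sup>2 * (norm (c (snd p)))\<^sup>2)"
      by (simp add: power_mult_distrib)
  qed
  also have "\<dots> = 4 ^ j * (\<Sum>p\<in>?I \<times> ?I. (norm (c (fst p)))\<^sup>2 * (norm (c (snd p)))\<^sup>2)"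
  proof -
    have "(\<lambda>p. madd (fst p) (snd p)) ` (?I \<times> ?I) \<subseteq> ?J"
      by (intro image_subsetI madd_in_indices_eq) (simp_all add: mem_Times_iff)
    then have "(\<Sum>\<gamma>\<in>?J. \<Sum>p\<in>?D \<gamma>. (norm (c (fst p)))\<^sup>2 * (norm (c (snd p)))\<^sup>2)
        = (\<Sum>p\<in>?I \<times> ?I. (norm (c (fst p)))\<^sup>2 * (norm (c (snd p)))\<^sup>2)"
      by (intro sum.group finite_cartesian_product finite_indices_eq)
    then show ?thesis by (simp only: sum_distrib_left[symmetric])
  qed
  also have "\<dots> = 4 ^ j * (\<Sum>\<alpha>\<in>?I. (norm (c \<alpha>))\<^sup>2)\<^sup>2"
    unfolding power2_eq_square[of "sum _ _"] sum_product sum.cartesian_product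
    by (simp add: split_def)
  finally show ?thesis unfolding moment mult.assoc by (intro mult_left_mono) auto
qed

text \<open>Hoelder's inequality between the exponents r = 2k/(k+1) and 4, proved by summing Young's
  inequality for normalized terms. The weights \<open>a\<close> and \<open>b\<close> are determined
  by a + b = 1 and r a + 4 b = 2.\<close>

lemma sum_squares_interpolation:
  fixes f :: "'a \<Rightarrow> real"
  assumes "finite \<Omega>" "\<And>x. x \<in> \<Omega> \<Longrightarrow> f x \<ge> 0"
  shows "(\<Sum>x\<in>\<Omega>. (f x)\<^sup>2) \<le> (\<Sum>x\<in>\<Omega>. f x powr (2 * real k / (real k + 1))) powr ((real k + 1) / (real k + 2))
            * (\<Sum>x\<in>\<Omega>. (f x) ^ 4) powr (1 / (real k + 2))"
proof (cases "\<exists>x\<in>\<Omega>. f x > 0")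
  case False
  then have "f x = 0" if "x \<in> \<Omega>" for x using assms(2)[OF that] that by force
  then show ?thesis by simp
next
  case True
  then obtain x0 where x0: "x0 \<in> \<Omega>" "f x0 > 0" by blast
  define r where "r = 2 * real k / (real k + 1)"
  define a b where "a = (real k + 1) / (real k + 2)" and "b = 1 / (real k + 2)"
  have ab: "a \<ge> 0" "b \<ge> 0" "a + b = 1" "r * a + 4 * b = 2"
  proof -
    have "r * a = 2 * real k / (real k + 2)" by (simp add: r_def a_def)
    then have "r * a + 4 * b = (2 * real k + 4) / (real k + 2)" by (simp add: b_def add_divide_distrib)
    also have "\<dots> = 2" by (simp add: field_simps)
    finally show "r * a + 4 * b = 2" .
  qed (auto simp: a_def b_def simp flip: add_divide_distrib)
  define u v where "u = (\<Sum>x\<in>\<Omega>. f x powr r)" and "v = (\<Sum>x\<in>\<Omega>. f x ^ 4)"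
  have u: "u > 0" unfolding u_def using x0 assms by (intro sum_pos2[of \<Omega> x0]) auto
  have v: "v > 0" unfolding v_def using x0 assms by (intro sum_pos2[of \<Omega> x0]) auto
  have "(f x)\<^sup>2 / (u powr a * v powr b) \<le> a * (f x powr r / u) + b * (f x ^ 4 / v)" if "x \<in> \<Omega>" for x
  proof (cases "f x = 0")
    case True
    then show ?thesis using ab u v by auto
  next
    case False
    then have fx: "f x > 0" using assms(2)[OF that] by simp
    have "(f x powr r / u) powr a * (f x ^ 4 / v) powr b \<le> a * (f x powr r / u) + b * (f x ^ 4 / v)"
      using fx u v by (intro Youngs_inequality_0 ab) auto
    also have "(f x powr r / u) powr a * (f x ^ 4 / v) powr b
        = f x powr (r * a + 4 * b) / (u powr a * v powr b)"
      using fx u v by (simp add: powr_divide powr_powr powr_add flip: powr_numeral)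
    finally show ?thesis using fx by (simp add: ab)
  qed
  then have "(\<Sum>x\<in>\<Omega>. (f x)\<^sup>2 / (u powr a * v powr b)) \<le> (\<Sum>x\<in>\<Omega>. a * (f x powr r / u) + b * (f x ^ 4 / v))"
    by (intro sum_mono)
  also have "\<dots> = a * (u / u) + b * (v / v)"
    by (simp add: u_def v_def sum.distrib flip: sum_distrib_left sum_divide_distrib)
  also have "\<dots> = 1" using u v ab by simp
  finally have "(\<Sum>x\<in>\<Omega>. (f x)\<^sup>2) \<le> u powr a * v powr b"
    using u v by (simp add: field_simps flip: sum_divide_distrib)
  then show ?thesis unfolding u_def v_def a_def b_def r_def .
qed

text \<open>Interpolating \<open>L_2\<close> between \<open>L_r\<close>, r = 2k/(k+1), and
  \<open>L_4\<close>, and inserting the fourth moment bound, leaves powers of the \<open>L_2\<close>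
  norm on both sides; solving for it is linear after taking logarithms. For k > 0 the result bounds
  the \<open>L_2\<close> norm by 2^(j/k) times the \<open>L_r\<close> norm, both raised to the power
  r.\<close>

lemma polynomial_hypercontractivity:
  assumes N: "N > 2 * j"
  shows "real N ^ n * (\<Sum>\<alpha>\<in>indices_eq j n. (norm (c \<alpha>))\<^sup>2) powr (real k / (real k + 1))
      \<le> 2 powr (2 * real j / (real k + 1)) *
        (\<Sum>z\<in>roots_grid N n. norm (cpoly n (indices_eq j n) c z) powr (2 * real k / (real k + 1)))"
proof (cases "(\<Sum>\<alpha>\<in>indices_eq j n. (norm (c \<alpha>))\<^sup>2) = 0")
  case True
  then show ?thesis by (auto intro!: mult_nonneg_nonneg sum_nonneg)
next
  case False
  let ?I = "indices_eq j n"
  define \<mu> where "\<mu> = (\<Sum>\<alpha>\<in>?I. (norm (c \<alpha>))\<^sup>2)"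
  define W where "W = real N ^ n"
  define u where "u = (\<Sum>z\<in>roots_grid N n. norm (cpoly n ?I c z) powr (2 * real k / (real k + 1)))"
  have \<mu>: "\<mu> > 0" using False sum_nonneg[of ?I "\<lambda>\<alpha>. (norm (c \<alpha>))\<^sup>2"] by (simp add: \<mu>_def less_le)
  have W: "W > 0" using N by (simp add: W_def)
  have lt: "\<alpha> i < N" if "\<alpha> \<in> ?I" "i < n" for \<alpha> i
  proof -
    have "\<alpha> \<in> below n (\<lambda>_. j)" using that indices_eq_subset_le indices_le_subset_below by blast
    then have "\<alpha> i \<le> j" using that(2) unfolding below_def by blast
    then show ?thesis using N by simp
  qed
  have "W * \<mu> = (\<Sum>z\<in>roots_grid N n. (norm (cpoly n ?I c z))\<^sup>2)"
    unfolding W_def \<mu>_def using lt N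
    by (intro parseval_roots_grid[symmetric] finite_indices_eq) (auto simp: indices_eq_def)
  also have "\<dots> \<le> u powr ((real k + 1) / (real k + 2))
      * (\<Sum>z\<in>roots_grid N n. norm (cpoly n ?I c z) ^ 4) powr (1 / (real k + 2))"
    unfolding u_def using N by (intro sum_squares_interpolation finite_roots_grid) auto
  also have "\<dots> \<le> u powr ((real k + 1) / (real k + 2)) * (W * 4 ^ j * \<mu>\<^sup>2) powr (1 / (real k + 2))"
    using fourth_moment_bound[OF N, of n c]
    by (intro mult_left_mono powr_mono2) (auto simp: W_def \<mu>_def sum_nonneg)
  finally have main: "W * \<mu> \<le> u powr ((real k + 1) / (real k + 2)) * (W * 4 ^ j * \<mu>\<^sup>2) powr (1 / (real k + 2))" .
  \<comment> \<open>If u were 0, \<open>main\<close> would bound the positive number W \<mu> by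
    0.\<close>
  have u: "u > 0"
  proof -
    have "u \<ge> 0" unfolding u_def by (intro sum_nonneg) auto
    moreover have "u \<noteq> 0" using main mult_pos_pos[OF W \<mu>] by (metis mult_zero_left not_le powr_0)
    ultimately show ?thesis by simp
  qed
  have "ln (W * \<mu>) \<le> ln (u powr ((real k + 1) / (real k + 2)) * (W * 4 ^ j * \<mu>\<^sup>2) powr (1 / (real k + 2)))"
    using main W \<mu> u by (subst ln_le_cancel_iff) auto
  also have "\<dots> = ((real k + 1) * ln u + (ln W + real j * ln 4 + 2 * ln \<mu>)) / (real k + 2)"
    using W \<mu> u by (simp add: ln_mult ln_powr ln_realpow flip: add_divide_distrib)
  finally have "(real k + 2) * (ln W + ln \<mu>) \<le> (real k + 1) * ln u + (ln W + real j * ln 4 + 2 * ln \<mu>)"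
    using W \<mu> by (simp add: ln_mult field_simps)
  moreover have "ln 4 = 2 * ln (2::real)" using ln_realpow[of 2 2] by simp
  ultimately have "(real k + 1) * ln W + real k * ln \<mu> \<le> (real k + 1) * ln u + 2 * real j * ln 2"
    by (simp add: algebra_simps)
  then have "((real k + 1) * ln W + real k * ln \<mu>) / (real k + 1)
      \<le> ((real k + 1) * ln u + 2 * real j * ln 2) / (real k + 1)"
    by (intro divide_right_mono) auto
  then have "ln W + real k / (real k + 1) * ln \<mu> \<le> 2 * real j / (real k + 1) * ln 2 + ln u"
    by (simp add: add_divide_distrib)
  then have "ln (W * \<mu> powr (real k / (real k + 1))) \<le> ln (2 powr (2 * real j / (real k + 1)) * u)"
    using W \<mu> u by (simp add: ln_mult ln_powr)
  then show ?thesis using W \<mu> u unfolding W_def[symmetric] \<mu>_def[symmetric] u_def[symmetric]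
    by (subst (asm) ln_le_cancel_iff) auto
qed

section \<open>The Bohnenblust--Hille inequality on the polydisc\<close>

lemma cpoly_scale:
  "cpoly n (indices_eq m n) c (\<lambda>i. s * z i) = s ^ m * cpoly n (indices_eq m n) c z"
  unfolding cpoly_def sum_distrib_left
  by (intro sum.cong refl)
    (auto simp: indices_eq_def mdegree_def power_mult_distrib prod.distrib power_sum)

text \<open>A discrete Cauchy estimate: averaging over m + 1 equidistributed points of the circle of
  radius \<rho> isolates one coefficient of a polynomial of degree at most m.\<close>

lemma coefficient_bound:
  fixes q :: "nat \<Rightarrow> complex"
  assumes "\<rho> \<ge> 0" "k \<le> m" and B: "\<And>t. norm t \<le> \<rho> \<Longrightarrow> norm (\<Sum>j\<le>m. t ^ j * q j) \<le> B"
  shows "norm (q k) * \<rho> ^ k \<le> B"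
proof -
  let ?R = "{z::complex. z ^ Suc m = 1}"
  have fin: "finite ?R" by (intro finite_roots_unity) auto
  have "(\<Sum>z\<in>?R. (\<Sum>j\<le>m. (of_real \<rho> * z) ^ j * q j) * cnj (z ^ k))
      = (\<Sum>j\<le>m. of_real \<rho> ^ j * q j * (\<Sum>z\<in>?R. z ^ j * cnj (z ^ k)))"
    unfolding sum_distrib_right sum_distrib_left
    by (subst sum.swap) (simp add: power_mult_distrib mult_ac)
  also have "\<dots> = (\<Sum>j\<le>m. if j = k then of_real \<rho> ^ k * q k * of_nat (Suc m) else 0)"
  proof (rule sum.cong[OF refl])
    fix j assume "j \<in> {..m}"
    then have "(\<Sum>z\<in>?R. z ^ j * cnj (z ^ k)) = (if j = k then of_nat (Suc m) else 0)"
      using assms by (intro sum_roots_unity_orthogonal) auto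
    then show "of_real \<rho> ^ j * q j * (\<Sum>z\<in>?R. z ^ j * cnj (z ^ k))
        = (if j = k then of_real \<rho> ^ k * q k * of_nat (Suc m) else 0)" by simp
  qed
  also have "\<dots> = of_real \<rho> ^ k * q k * of_nat (Suc m)"
    using assms by (simp add: sum.delta)
  finally have eq: "(\<Sum>z\<in>?R. (\<Sum>j\<le>m. (of_real \<rho> * z) ^ j * q j) * cnj (z ^ k))
      = of_real \<rho> ^ k * q k * of_nat (Suc m)" .
  have "norm (of_real \<rho> ^ k * q k * of_nat (Suc m))
      \<le> (\<Sum>z\<in>?R. norm ((\<Sum>j\<le>m. (of_real \<rho> * z) ^ j * q j) * cnj (z ^ k)))"
    unfolding eq[symmetric] by (rule norm_sum)
  also have "\<dots> \<le> (\<Sum>z\<in>?R. B)"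
  proof (rule sum_mono)
    fix z assume "z \<in> ?R"
    then have z: "norm z = 1" by (intro norm_root_unity[of z "Suc m"]) auto
    show "norm ((\<Sum>j\<le>m. (of_real \<rho> * z) ^ j * q j) * cnj (z ^ k)) \<le> B"
      using B[of "of_real \<rho> * z"] z assms by (simp add: norm_mult norm_power)
  qed
  also have "\<dots> = of_nat (Suc m) * B"
    using card_roots_unity_eq[of "Suc m"] by simp
  finally have "real (Suc m) * (norm (q k) * \<rho> ^ k) \<le> real (Suc m) * B"
    using assms by (simp add: norm_mult norm_power mult_ac del: of_nat_Suc)
  then show ?thesis by (rule mult_left_le_imp_le) simp
qed

text \<open>For fixed \<gamma> these are, as a function of \<beta>, the coefficients of the
  derivative of order \<gamma> divided by \<gamma>!, for the polynomial with coefficients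
  \<open>c\<close>.\<close>

definition taylor_coeff :: "nat \<Rightarrow> ((nat \<Rightarrow> nat) \<Rightarrow> complex) \<Rightarrow> (nat \<Rightarrow> nat) \<Rightarrow> (nat \<Rightarrow> nat) \<Rightarrow> complex"
  where "taylor_coeff n c \<gamma> \<beta> = of_nat (\<Prod>i<n. (\<beta> i + \<gamma> i) choose \<gamma> i) * c (madd \<beta> \<gamma>)"

text \<open>Binomial coefficients with \<gamma> i at most \<beta> i + \<gamma> i are at least 1.
  Hence Taylor coefficients may replace the original ones in upper bounds.\<close>

lemma norm_taylor_coeff_ge: "norm (c (madd \<beta> \<gamma>)) \<le> norm (taylor_coeff n c \<gamma> \<beta>)"
proof -
  have "1 \<le> (\<Prod>i<n. (\<beta> i + \<gamma> i) choose \<gamma> i)"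
    by (intro prod_ge_1) (simp add: Suc_leI)
  then have "1 \<le> real (\<Prod>i<n. (\<beta> i + \<gamma> i) choose \<gamma> i)"
    using of_nat_mono by fastforce
  then show ?thesis
    unfolding taylor_coeff_def norm_mult norm_of_nat
    using mult_right_mono[of 1 _ "norm (c (madd \<beta> \<gamma>))"] by fastforce
qed

text \<open>Every factor is expanded by the binomial theorem, and the terms are sorted by the
  multi-index \<gamma> of the powers of w and its degree k.\<close>

lemma cpoly_taylor:
  "cpoly n (indices_eq m n) c (\<lambda>i. z i + t * w i) =
    (\<Sum>k\<le>m. t ^ k * cpoly n (indices_eq k n) (\<lambda>\<gamma>. cpoly n (indices_eq (m - k) n) (taylor_coeff n c \<gamma>) z) w)"
proof -
  define g where "g = (\<lambda>(\<alpha>, \<gamma>). c \<alpha> * (\<Prod>i<n. of_nat (\<alpha> i choose \<gamma> i) * (t * w i) ^ \<gamma> i * z i ^ (\<alpha> i - \<gamma> i)))"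
  define h where "h = (\<lambda>(k::nat, \<gamma>, \<beta>). t ^ k * (taylor_coeff n c \<gamma> \<beta> * (\<Prod>i<n. z i ^ \<beta> i) * (\<Prod>i<n. w i ^ \<gamma> i)))"
  have "cpoly n (indices_eq m n) c (\<lambda>i. z i + t * w i)
      = (\<Sum>\<alpha>\<in>indices_eq m n. \<Sum>\<gamma>\<in>below n \<alpha>. g (\<alpha>, \<gamma>))"
    unfolding cpoly_def
  proof (intro sum.cong refl)
    fix \<alpha>
    have "(\<Prod>i<n. (z i + t * w i) ^ \<alpha> i)
        = (\<Prod>i<n. \<Sum>j\<le>\<alpha> i. of_nat (\<alpha> i choose j) * (t * w i) ^ j * z i ^ (\<alpha> i - j))"
      by (intro prod.cong refl) (simp add: add.commute[of "z _"] binomial_ring)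
    also have "\<dots> = (\<Sum>\<gamma>\<in>below n \<alpha>. \<Prod>i<n. of_nat (\<alpha> i choose \<gamma> i) * (t * w i) ^ \<gamma> i * z i ^ (\<alpha> i - \<gamma> i))"
      by (rule prod_sum_below)
    finally show "c \<alpha> * (\<Prod>i<n. (z i + t * w i) ^ \<alpha> i) = (\<Sum>\<gamma>\<in>below n \<alpha>. g (\<alpha>, \<gamma>))"
      by (simp add: g_def sum_distrib_left)
  qed
  also have "\<dots> = (\<Sum>p\<in>Sigma (indices_eq m n) (below n). g p)"
    by (subst sum.Sigma) (auto simp: finite_indices_eq finite_below)
  also have "\<dots> = (\<Sum>q\<in>Sigma {..m} (\<lambda>k. indices_eq k n \<times> indices_eq (m - k) n). h q)"
  \<comment> \<open>Truncated subtraction is harmless here because \<gamma> lies below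
    \<alpha>.\<close>
  proof (rule sum.reindex_bij_witness[where j = "\<lambda>(\<alpha>, \<gamma>). (mdegree n \<gamma>, \<gamma>, \<lambda>i. \<alpha> i - \<gamma> i)"
        and i = "\<lambda>(k, \<gamma>, \<beta>). (madd \<beta> \<gamma>, \<gamma>)"])
    fix p assume p: "p \<in> Sigma (indices_eq m n) (below n)"
    obtain \<alpha> \<gamma> where p_eq: "p = (\<alpha>, \<gamma>)" by (cases p)
    have \<alpha>: "\<alpha> \<in> multi_indices n" "mdegree n \<alpha> = m" and \<gamma>: "\<gamma> \<in> multi_indices n" "\<And>i. i < n \<Longrightarrow> \<gamma> i \<le> \<alpha> i"
      using p by (auto simp: p_eq indices_eq_def below_def)
    have add: "\<alpha> i - \<gamma> i + \<gamma> i = \<alpha> i" for i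
      using \<alpha> \<gamma> by (cases "i < n") (auto simp: multi_indices_def)
    then have madd: "madd (\<lambda>i. \<alpha> i - \<gamma> i) \<gamma> = \<alpha>"
      by (auto simp: madd_def)
    then show "(case (case p of (\<alpha>, \<gamma>) \<Rightarrow> (mdegree n \<gamma>, \<gamma>, \<lambda>i. \<alpha> i - \<gamma> i)) of (k, \<gamma>, \<beta>) \<Rightarrow> (madd \<beta> \<gamma>, \<gamma>)) = p"
      by (simp add: p_eq)
    have deg: "mdegree n \<alpha> = mdegree n (\<lambda>i. \<alpha> i - \<gamma> i) + mdegree n \<gamma>"
      unfolding mdegree_def sum.distrib[symmetric] add ..
    then show "(case p of (\<alpha>, \<gamma>) \<Rightarrow> (mdegree n \<gamma>, \<gamma>, \<lambda>i. \<alpha> i - \<gamma> i))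
        \<in> Sigma {..m} (\<lambda>k. indices_eq k n \<times> indices_eq (m - k) n)"
      using \<alpha> \<gamma> by (auto simp: p_eq indices_eq_def multi_indices_def)
    have "t ^ mdegree n \<gamma> = (\<Prod>i<n. t ^ \<gamma> i)"
      by (simp add: mdegree_def power_sum)
    then show "h (case p of (\<alpha>, \<gamma>) \<Rightarrow> (mdegree n \<gamma>, \<gamma>, \<lambda>i. \<alpha> i - \<gamma> i)) = g p"
      by (simp add: p_eq h_def g_def taylor_coeff_def madd add prod.distrib power_mult_distrib)
  next
    fix q assume q: "q \<in> Sigma {..m} (\<lambda>k. indices_eq k n \<times> indices_eq (m - k) n)"
    obtain k \<gamma> \<beta> where q_eq: "q = (k, \<gamma>, \<beta>)" by (cases q)
    have *: "k \<le> m" "\<gamma> \<in> indices_eq k n" "\<beta> \<in> indices_eq (m - k) n"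
      using q by (auto simp: q_eq)
    show "(case (case q of (k, \<gamma>, \<beta>) \<Rightarrow> (madd \<beta> \<gamma>, \<gamma>)) of (\<alpha>, \<gamma>) \<Rightarrow> (mdegree n \<gamma>, \<gamma>, \<lambda>i. \<alpha> i - \<gamma> i)) = q"
      using * by (simp add: q_eq madd_def indices_eq_def)
    show "(case q of (k, \<gamma>, \<beta>) \<Rightarrow> (madd \<beta> \<gamma>, \<gamma>)) \<in> Sigma (indices_eq m n) (below n)"
      using madd_in_indices_eq[OF *(3,2)] * by (auto simp: q_eq below_def madd_def indices_eq_def)
  qed
  also have "\<dots> = (\<Sum>k\<le>m. \<Sum>(\<gamma>, \<beta>)\<in>indices_eq k n \<times> indices_eq (m - k) n. h (k, \<gamma>, \<beta>))"
    by (subst sum.Sigma) (auto simp: finite_indices_eq split_def)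
  also have "\<dots> = (\<Sum>k\<le>m. t ^ k * cpoly n (indices_eq k n) (\<lambda>\<gamma>. cpoly n (indices_eq (m - k) n) (taylor_coeff n c \<gamma>) z) w)"
    by (simp add: cpoly_def h_def sum_distrib_left sum_distrib_right sum.cartesian_product split_def)
  finally show ?thesis .
qed

text \<open>If \<open>\<bar>P\<bar> \<le> 1\<close> on the polydisc, then \<open>P (z + t w)\<close> has modulus at most \<open>(1 + 1/m) ^ m \<le> e\<close> for \<open>\<bar>t\<bar> = 1/m\<close>, so extracting one
  Taylor coefficient of fixed order \<open>k\<close> costs only a polynomial factor in \<open>m\<close>.\<close>

lemma taylor_component_bound:
  assumes "m > 0" "k \<le> m"
    and P: "\<And>z. (\<And>i. i < n \<Longrightarrow> norm (z i) \<le> 1) \<Longrightarrow> norm (cpoly n (indices_eq m n) c z) \<le> M"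
    and z: "\<And>i. i < n \<Longrightarrow> norm (z i) \<le> 1" and w: "\<And>i. i < n \<Longrightarrow> norm (w i) \<le> 1"
  shows "norm (cpoly n (indices_eq k n) (\<lambda>\<gamma>. cpoly n (indices_eq (m - k) n) (taylor_coeff n c \<gamma>) z) w)
      \<le> exp 1 * real m ^ k * M"
proof -
  define s where "s = 1 + 1 / real m"
  have s: "s > 0" using assms by (simp add: s_def add_pos_nonneg)
  have M: "M \<ge> 0" by (rule order_trans[OF norm_ge_zero P[of "\<lambda>_. 0"]]) simp
  have "norm (cpoly n (indices_eq k n) (\<lambda>\<gamma>. cpoly n (indices_eq (m - k) n) (taylor_coeff n c \<gamma>) z) w)
      * (1 / real m) ^ k \<le> exp 1 * M"
  proof (rule coefficient_bound[where m = m])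
    fix t :: complex assume t: "norm t \<le> 1 / real m"
    \<comment> \<open>Division by s brings the point back into the polydisc; homogeneity restores
      the factor s^m.\<close>
    define x where "x = (\<lambda>i. (z i + t * w i) / of_real s)"
    have "norm (x i) \<le> 1" if "i < n" for i
    proof -
      have "norm (z i + t * w i) \<le> norm (z i) + norm t * norm (w i)"
        by (metis norm_mult norm_triangle_ineq)
      also have "\<dots> \<le> 1 + 1 / real m * 1"
        using z[OF that] w[OF that] t by (intro add_mono mult_mono) auto
      also have "\<dots> = s" by (simp add: s_def)
      finally show ?thesis using s by (simp add: x_def norm_divide)
    qed
    then have Px: "norm (cpoly n (indices_eq m n) c x) \<le> M" by (rule P)
    have "s ^ m \<le> exp (1 / real m) ^ m"
      unfolding s_def by (intro power_mono) (auto intro: exp_ge_add_one_self)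
    also have "\<dots> = exp 1" using assms by (simp flip: exp_of_nat_mult)
    finally have "s ^ m * norm (cpoly n (indices_eq m n) c x) \<le> exp 1 * M"
      using Px M by (intro mult_mono) auto
    moreover have "cpoly n (indices_eq m n) c (\<lambda>i. z i + t * w i) = of_real s ^ m * cpoly n (indices_eq m n) c x"
      unfolding cpoly_scale[symmetric] x_def using s by simp
    ultimately show "norm (\<Sum>j\<le>m. t ^ j * cpoly n (indices_eq j n) (\<lambda>\<gamma>. cpoly n (indices_eq (m - j) n) (taylor_coeff n c \<gamma>) z) w)
        \<le> exp 1 * M"
      using s unfolding cpoly_taylor[symmetric] by (simp add: norm_mult norm_power)
  qed (use assms in auto)
  then show ?thesis using assms by (simp add: field_simps)
qed

section \<open>Block decompositions and the Bohnenblust--Hille inequality for forms\<close>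

text \<open>By induction on a: one unit at a positive entry of \<gamma> is moved to \<beta>.\<close>

lemma indices_eq_split:
  "\<alpha> \<in> indices_eq (a + b) n \<Longrightarrow> \<exists>\<beta>\<in>indices_eq a n. \<exists>\<gamma>\<in>indices_eq b n. \<alpha> = madd \<beta> \<gamma>"
proof (induction a arbitrary: b)
  case 0
  then have "(\<lambda>_. 0) \<in> indices_eq 0 n" "\<alpha> = madd (\<lambda>_. 0) \<alpha>" "\<alpha> \<in> indices_eq b n"
    by (auto simp: indices_eq_def multi_indices_def mdegree_def madd_def)
  then show ?case by blast
next
  case (Suc a)
  then have "\<alpha> \<in> indices_eq (a + Suc b) n" by simp
  from Suc.IH[OF this] obtain \<beta> \<gamma>
    where *: "\<beta> \<in> indices_eq a n" "\<gamma> \<in> indices_eq (Suc b) n" "\<alpha> = madd \<beta> \<gamma>" by blast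
  then have "(\<Sum>i<n. \<gamma> i) \<noteq> 0" by (auto simp: indices_eq_def mdegree_def)
  then obtain j where j: "j < n" "\<gamma> j > 0" by auto
  have split: "(\<Sum>i<n. f i) = f j + (\<Sum>i\<in>{..<n} - {j}. f i)" for f :: "nat \<Rightarrow> nat"
    using j by (simp add: sum.remove)
  have "\<beta>(j := Suc (\<beta> j)) \<in> indices_eq (Suc a) n" "\<gamma>(j := \<gamma> j - 1) \<in> indices_eq b n"
    using * j by (auto simp: indices_eq_def multi_indices_def mdegree_def split)
  moreover have "\<alpha> = madd (\<beta>(j := Suc (\<beta> j))) (\<gamma>(j := \<gamma> j - 1))"
    using * j by (auto simp: madd_def fun_eq_iff)
  ultimately show ?case by blast
qed

lemma indices_eq_split_family:
  assumes "finite T" "\<alpha> \<in> indices_eq (sum k T) n"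
  shows "\<exists>g. (\<forall>t\<in>T. g t \<in> indices_eq (k t) n) \<and> \<alpha> = (\<lambda>i. \<Sum>t\<in>T. g t i)"
  using assms
proof (induction T arbitrary: \<alpha> rule: finite_induct)
  case empty
  then have "\<alpha> \<in> multi_indices n" "\<And>i. i < n \<Longrightarrow> \<alpha> i = 0"
    by (auto simp: indices_eq_def mdegree_def)
  then have "\<alpha> = (\<lambda>i. 0)"
    by (intro multi_indices_eqI[of _ n]) (auto simp: multi_indices_def)
  then show ?case by simp
next
  case (insert s T)
  then obtain \<beta> \<gamma> where *: "\<beta> \<in> indices_eq (k s) n" "\<gamma> \<in> indices_eq (sum k T) n" "\<alpha> = madd \<beta> \<gamma>"
    using indices_eq_split[of \<alpha> "k s" "sum k T" n] by auto
  then obtain g where g: "\<forall>t\<in>T. g t \<in> indices_eq (k t) n" "\<gamma> = (\<lambda>i. \<Sum>t\<in>T. g t i)"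
    using insert.IH by blast
  have "(\<Sum>t\<in>T. (g(s := \<beta>)) t i) = (\<Sum>t\<in>T. g t i)" for i
    using insert.hyps by (intro sum.cong) auto
  then show ?case
    using * g insert.hyps by (intro exI[of _ "g(s := \<beta>)"]) (auto simp: madd_def)
qed

text \<open>Any bound M on the polydisc takes the place of the supremum, and both sides are raised
  to the power 2m/(m+1), which avoids suprema and roots.\<close>

definition complex_BH :: "nat \<Rightarrow> real \<Rightarrow> bool" where
  "complex_BH m C \<longleftrightarrow> (\<forall>n c M. (\<forall>z. (\<forall>i<n. norm (z i) \<le> 1) \<longrightarrow> norm (cpoly n (indices_eq m n) c z) \<le> M) \<longrightarrow>
     (\<Sum>\<alpha>\<in>indices_eq m n. norm (c \<alpha>) powr (2 * real m / (real m + 1))) \<le> (C * M) powr (2 * real m / (real m + 1)))"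

text \<open>For each \<gamma>, hypercontractivity replaces the \<open>\<ell>\<^sub>2\<close> norm
  over \<beta> by a grid average of the power r = 2k/(k+1). This is also the exponent of the degree
  k inequality, so after exchanging sum and average that inequality applies in w at each fixed grid
  point z.\<close>

lemma block_sum_bound:
  assumes m: "m > 0" "k \<le> m" and C: "complex_BH k C" "C \<ge> 0"
    and P: "\<And>z. (\<And>i. i < n \<Longrightarrow> norm (z i) \<le> 1) \<Longrightarrow> norm (cpoly n (indices_eq m n) c z) \<le> M"
  shows "(\<Sum>\<gamma>\<in>indices_eq k n. (\<Sum>\<beta>\<in>indices_eq (m - k) n. (norm (taylor_coeff n c \<gamma> \<beta>))\<^sup>2) powr (real k / (real k + 1)))
      \<le> 2 powr (2 * real m / (real k + 1)) * (C * (exp 1 * real m ^ k * M)) powr (2 * real k / (real k + 1))"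
proof -
  \<comment> \<open>Large enough for hypercontractivity in degree m - k.\<close>
  define N where "N = 2 * m + 1"
  define r where "r = 2 * real k / (real k + 1)"
  define W where "W = real N ^ n"
  define B where "B = (C * (exp 1 * real m ^ k * M)) powr r"
  have W: "W > 0" by (simp add: W_def N_def)
  have "W * (\<Sum>\<gamma>\<in>indices_eq k n. (\<Sum>\<beta>\<in>indices_eq (m - k) n. (norm (taylor_coeff n c \<gamma> \<beta>))\<^sup>2) powr (real k / (real k + 1)))
      \<le> (\<Sum>\<gamma>\<in>indices_eq k n. 2 powr (2 * real (m - k) / (real k + 1)) *
          (\<Sum>z\<in>roots_grid N n. norm (cpoly n (indices_eq (m - k) n) (taylor_coeff n c \<gamma>) z) powr r))"
    unfolding sum_distrib_left W_def r_def
    by (intro sum_mono polynomial_hypercontractivity[unfolded sum_distrib_left]) (simp add: N_def)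
  also have "\<dots> = 2 powr (2 * real (m - k) / (real k + 1)) *
      (\<Sum>z\<in>roots_grid N n. \<Sum>\<gamma>\<in>indices_eq k n. norm (cpoly n (indices_eq (m - k) n) (taylor_coeff n c \<gamma>) z) powr r)"
    unfolding sum_distrib_left[symmetric] by (subst sum.swap) (rule refl)
  also have "\<dots> \<le> 2 powr (2 * real m / (real k + 1)) * (\<Sum>z\<in>roots_grid N n. B)"
  proof (intro mult_mono sum_mono)
    fix z assume z: "z \<in> roots_grid N n"
    have zn: "norm (z i) \<le> 1" if "i < n" for i
      using norm_roots_grid[OF z _ that] by (simp add: N_def)
    have "norm (cpoly n (indices_eq k n) (\<lambda>\<gamma>. cpoly n (indices_eq (m - k) n) (taylor_coeff n c \<gamma>) z) w)
        \<le> exp 1 * real m ^ k * M" if "\<forall>i<n. norm (w i) \<le> 1" for w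
      using that zn by (intro taylor_component_bound m P) auto
    then show "(\<Sum>\<gamma>\<in>indices_eq k n. norm (cpoly n (indices_eq (m - k) n) (taylor_coeff n c \<gamma>) z) powr r) \<le> B"
      using C(1)[unfolded complex_BH_def] unfolding B_def r_def by blast
  next
    show "2 powr (2 * real (m - k) / (real k + 1)) \<le> (2::real) powr (2 * real m / (real k + 1))"
      by (intro powr_mono divide_right_mono) auto
  qed (auto simp: sum_nonneg)
  also have "\<dots> = W * (2 powr (2 * real m / (real k + 1)) * B)"
    by (simp add: card_roots_grid N_def W_def)
  finally show ?thesis
    using W unfolding B_def r_def by (simp only: mult_le_cancel_left_pos)
qed

text \<open>Blei's inequality is applied with the blocks of a multi-index as its coordinates. The
  mixed norm of each block is bounded by the inequality of degree \<open>k t\<close>, and the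
  resulting exponents 2 k t/(m+1) of the common bound K M add up to 2m/(m+1).\<close>

lemma complex_BH_step:
  fixes T :: "'t set"
  assumes T: "finite T" "T \<noteq> {}" and k: "\<And>t. t \<in> T \<Longrightarrow> k t > 0" and m: "m = sum k T"
    and C: "\<And>t. t \<in> T \<Longrightarrow> complex_BH (k t) (C t)" "\<And>t. t \<in> T \<Longrightarrow> C t \<ge> 0"
    and K: "\<And>t. t \<in> T \<Longrightarrow> 2 powr (real m / real (k t)) * (C t * exp 1 * real m ^ k t) \<le> K"
  shows "complex_BH m K"
  unfolding complex_BH_def
proof (intro allI impI)
  fix n c M
  assume "\<forall>z. (\<forall>i<n. norm (z i) \<le> 1) \<longrightarrow> norm (cpoly n (indices_eq m n) c z) \<le> M"
  then have P: "norm (cpoly n (indices_eq m n) c z) \<le> M" if "\<And>i. i < n \<Longrightarrow> norm (z i) \<le> 1" for z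
    using that by blast
  have M: "M \<ge> 0" by (rule order_trans[OF norm_ge_zero P[of "\<lambda>_. 0"]]) simp
  have km: "k t \<le> m" if "t \<in> T" for t unfolding m using T that by (intro member_le_sum) auto
  obtain t0 where "t0 \<in> T" using T by blast
  then have m0: "m > 0" using k[of t0] km[of t0] by linarith
  \<comment> \<open>Blei's inequality is stated for positive numbers, so vanishing coefficients are
    dropped.\<close>
  define A where "A = {\<alpha> \<in> indices_eq m n. c \<alpha> \<noteq> 0}"
  define p where "p = 2 * real m / (real m + 1)"
  have finA: "finite A" unfolding A_def by (rule finite_subset[OF _ finite_indices_eq]) auto
  \<comment> \<open>The decomposition is not unique. One is fixed for every \<alpha>; since \<alpha>
    is the sum of its blocks, the blocks determine it.\<close>
  have "\<forall>\<alpha>\<in>A. \<exists>g. (\<forall>t\<in>T. g t \<in> indices_eq (k t) n) \<and> \<alpha> = (\<lambda>i. \<Sum>t\<in>T. g t i)"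
    unfolding A_def m using indices_eq_split_family[OF T(1)] by blast
  then obtain G where G: "\<And>\<alpha> t. \<alpha> \<in> A \<Longrightarrow> t \<in> T \<Longrightarrow> G \<alpha> t \<in> indices_eq (k t) n"
      "\<And>\<alpha>. \<alpha> \<in> A \<Longrightarrow> \<alpha> = (\<lambda>i. \<Sum>t\<in>T. G \<alpha> t i)"
    by metis
  define \<pi> where "\<pi> t \<alpha> = G \<alpha> t" for t \<alpha>
  have N_bound: "(\<Sum>x\<in>\<pi> t ` A. (\<Sum>\<alpha>\<in>{\<alpha>\<in>A. \<pi> t \<alpha> = x}. (norm (c \<alpha>))\<^sup>2) powr (real (k t) / (real (k t) + 1)))
      \<le> (K * M) powr (2 * real (k t) / (real (k t) + 1))" if t: "t \<in> T" for t
  proof -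
    have "(\<Sum>x\<in>\<pi> t ` A. (\<Sum>\<alpha>\<in>{\<alpha>\<in>A. \<pi> t \<alpha> = x}. (norm (c \<alpha>))\<^sup>2) powr (real (k t) / (real (k t) + 1)))
        \<le> (\<Sum>x\<in>\<pi> t ` A. (\<Sum>\<beta>\<in>indices_eq (m - k t) n. (norm (taylor_coeff n c x \<beta>))\<^sup>2) powr (real (k t) / (real (k t) + 1)))"
    proof (intro sum_mono powr_mono2)
      fix x assume "x \<in> \<pi> t ` A"
      show "(\<Sum>\<alpha>\<in>{\<alpha>\<in>A. \<pi> t \<alpha> = x}. (norm (c \<alpha>))\<^sup>2) \<le> (\<Sum>\<beta>\<in>indices_eq (m - k t) n. (norm (taylor_coeff n c x \<beta>))\<^sup>2)"
      \<comment> \<open>Removing the block x from \<alpha> leaves the sum \<beta> of the other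
        blocks, so each \<alpha> is covered by a term of the sum over \<beta>.\<close>
      proof (rule sum_le_included[where i = "\<lambda>\<beta>. madd \<beta> x"])
        show "\<forall>\<alpha>\<in>{\<alpha>\<in>A. \<pi> t \<alpha> = x}. \<exists>\<beta>\<in>indices_eq (m - k t) n. madd \<beta> x = \<alpha> \<and> (norm (c \<alpha>))\<^sup>2 \<le> (norm (taylor_coeff n c x \<beta>))\<^sup>2"
        proof
          fix \<alpha> assume \<alpha>: "\<alpha> \<in> {\<alpha>\<in>A. \<pi> t \<alpha> = x}"
          define \<beta> where "\<beta> = (\<lambda>i. \<Sum>s\<in>T - {t}. G \<alpha> s i)"
          have G\<alpha>: "G \<alpha> s \<in> indices_eq (k s) n" if "s \<in> T" for s using G(1) \<alpha> that by auto
          have "\<alpha> = (\<lambda>i. \<Sum>s\<in>T. G \<alpha> s i)" using G(2) \<alpha> by blast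
          also have "\<dots> = madd \<beta> x"
            using \<alpha> T t by (auto simp: madd_def \<beta>_def \<pi>_def sum.remove[of T t])
          finally have "madd \<beta> x = \<alpha>" ..
          moreover have "\<beta> \<in> indices_eq (m - k t) n"
          proof -
            have "mdegree n \<beta> = (\<Sum>s\<in>T - {t}. mdegree n (G \<alpha> s))"
              unfolding mdegree_def \<beta>_def by (rule sum.swap)
            also have "\<dots> = (\<Sum>s\<in>T - {t}. k s)"
              using G\<alpha> by (intro sum.cong) (auto simp: indices_eq_def)
            also have "\<dots> = m - k t" unfolding m using T t by (simp add: sum.remove[of T t])
            finally show ?thesis
              using G\<alpha> by (auto simp: indices_eq_def multi_indices_def \<beta>_def)
          qed
          ultimately show "\<exists>\<beta>\<in>indices_eq (m - k t) n. madd \<beta> x = \<alpha> \<and> (norm (c \<alpha>))\<^sup>2 \<le> (norm (taylor_coeff n c x \<beta>))\<^sup>2"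
            using norm_taylor_coeff_ge[of c \<beta> x n] by (intro bexI[of _ \<beta>]) (auto intro: power_mono)
        qed
      qed (auto simp: finA finite_indices_eq)
    qed (auto simp: sum_nonneg)
    also have "\<dots> \<le> (\<Sum>x\<in>indices_eq (k t) n. (\<Sum>\<beta>\<in>indices_eq (m - k t) n. (norm (taylor_coeff n c x \<beta>))\<^sup>2) powr (real (k t) / (real (k t) + 1)))"
      using G(1) t by (intro sum_mono2 finite_indices_eq) (auto simp: \<pi>_def)
    also have "\<dots> \<le> 2 powr (2 * real m / (real (k t) + 1)) * (C t * (exp 1 * real m ^ k t * M)) powr (2 * real (k t) / (real (k t) + 1))"
      using t by (intro block_sum_bound m0 km C P)
    \<comment> \<open>Bringing all factors under the exponent 2 k t/(k t + 1) turns the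
      hypercontractive constant into 2^(m/k t), as in the hypothesis on K.\<close>
    also have "2 powr (2 * real m / (real (k t) + 1)) = (2 powr (real m / real (k t))) powr (2 * real (k t) / (real (k t) + 1))"
      using k[OF t] by (simp add: powr_powr mult_ac)
    also have "(2 powr (real m / real (k t))) powr (2 * real (k t) / (real (k t) + 1)) *
        (C t * (exp 1 * real m ^ k t * M)) powr (2 * real (k t) / (real (k t) + 1))
        = (2 powr (real m / real (k t)) * (C t * exp 1 * real m ^ k t) * M) powr (2 * real (k t) / (real (k t) + 1))"
      using C(2)[OF t] M by (simp add: powr_mult[symmetric] mult_ac)
    also have "\<dots> \<le> (K * M) powr (2 * real (k t) / (real (k t) + 1))"
      using K[OF t] M C(2)[OF t] by (intro powr_mono2 mult_right_mono) auto
    finally show ?thesis .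
  qed
  have "(\<Sum>\<alpha>\<in>indices_eq m n. norm (c \<alpha>) powr p) = (\<Sum>\<alpha>\<in>A. norm (c \<alpha>) powr p)"
    unfolding A_def by (rule sum.mono_neutral_right) (auto simp: finite_indices_eq)
  also have "\<dots> \<le> (\<Prod>t\<in>T. (\<Sum>x\<in>\<pi> t ` A. (\<Sum>\<alpha>\<in>{\<alpha>\<in>A. \<pi> t \<alpha> = x}. (norm (c \<alpha>))\<^sup>2) powr (real (k t) / (real (k t) + 1)))
                powr ((real (k t) + 1) / (real m + 1)))"
    unfolding p_def
  proof (rule Blei_inequality[OF finA T _ _ m])
    fix \<alpha> \<beta> assume "\<alpha> \<in> A" "\<beta> \<in> A" "\<And>t. t \<in> T \<Longrightarrow> \<pi> t \<alpha> = \<pi> t \<beta>"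
    then have "(\<lambda>i. \<Sum>t\<in>T. G \<alpha> t i) = (\<lambda>i. \<Sum>t\<in>T. G \<beta> t i)"
      unfolding \<pi>_def by simp
    then show "\<alpha> = \<beta>" using G(2) \<open>\<alpha> \<in> A\<close> \<open>\<beta> \<in> A\<close> by metis
  qed (auto simp: A_def)
  also have "\<dots> \<le> (\<Prod>t\<in>T. (K * M) powr (2 * real (k t) / (real m + 1)))"
  proof (rule prod_mono, intro conjI)
    fix t assume t: "t \<in> T"
    have "(\<Sum>x\<in>\<pi> t ` A. (\<Sum>\<alpha>\<in>{\<alpha>\<in>A. \<pi> t \<alpha> = x}. (norm (c \<alpha>))\<^sup>2) powr (real (k t) / (real (k t) + 1)))
                powr ((real (k t) + 1) / (real m + 1))
        \<le> ((K * M) powr (2 * real (k t) / (real (k t) + 1))) powr ((real (k t) + 1) / (real m + 1))"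
      using t by (intro powr_mono2 N_bound sum_nonneg) auto
    also have "\<dots> = (K * M) powr (2 * real (k t) / (real m + 1))"
    proof -
      have "(real (k t) + 1) \<noteq> 0" by linarith
      then show ?thesis unfolding powr_powr by simp
    qed
    finally show "(\<Sum>x\<in>\<pi> t ` A. (\<Sum>\<alpha>\<in>{\<alpha>\<in>A. \<pi> t \<alpha> = x}. (norm (c \<alpha>))\<^sup>2) powr (real (k t) / (real (k t) + 1)))
                powr ((real (k t) + 1) / (real m + 1)) \<le> (K * M) powr (2 * real (k t) / (real m + 1))" .
  qed auto
  also have "\<dots> = (K * M) powr p"
  proof (cases "K * M = 0")
    case True
    show ?thesis unfolding True using T by (simp add: card_gt_0_iff)
  next
    case False
    have "p = (\<Sum>t\<in>T. 2 * real (k t) / (real m + 1))"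
      unfolding p_def by (subst m) (simp add: sum_distrib_left sum_divide_distrib)
    then show ?thesis using False T by (simp add: powr_sum)
  qed
  finally show "(\<Sum>\<alpha>\<in>indices_eq m n. norm (c \<alpha>) powr (2 * real m / (real m + 1)))
      \<le> (K * M) powr (2 * real m / (real m + 1))"
    unfolding p_def .
qed

text \<open>In degree 1 the exponent is 1, and a linear form attains the sum of the moduli of its
  coefficients on the polydisc.\<close>

lemma complex_BH_1: "complex_BH 1 1"
  unfolding complex_BH_def
proof (intro allI impI)
  fix n c and M :: real
  assume P: "\<forall>z. (\<forall>i<n. norm (z i) \<le> 1) \<longrightarrow> norm (cpoly n (indices_eq 1 n) c z) \<le> M"
  define e where "e = (\<lambda>j i::nat. if i = j then 1 else 0 :: nat)"
  have inj: "inj_on e {..<n}" by (auto simp: inj_on_def e_def fun_eq_iff split: if_splits)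
  have eq: "indices_eq 1 n = e ` {..<n}"
  proof
    show "e ` {..<n} \<subseteq> indices_eq 1 n"
      by (auto simp: e_def indices_eq_def multi_indices_def mdegree_def)
    show "indices_eq 1 n \<subseteq> e ` {..<n}"
    proof
      fix \<alpha> assume \<alpha>: "\<alpha> \<in> indices_eq 1 n"
      then have "(\<Sum>i<n. \<alpha> i) = 1" by (simp add: indices_eq_def mdegree_def)
      then obtain j where j: "j < n" "\<alpha> j = 1" "\<forall>i<n. j \<noteq> i \<longrightarrow> \<alpha> i = 0"
        by (subst (asm) sum_eq_1_iff) auto
      then have "\<alpha> = e j"
        using \<alpha> by (intro multi_indices_eqI[of _ n]) (auto simp: indices_eq_def e_def multi_indices_def)
      then show "\<alpha> \<in> e ` {..<n}" using j by blast
    qed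
  qed
  \<comment> \<open>This choice rotates all summands onto the nonnegative real axis.\<close>
  define w where "w i = cnj (sgn (c (e i)))" for i
  have "cpoly n (indices_eq 1 n) c w = (\<Sum>j<n. c (e j) * (\<Prod>i<n. w i ^ e j i))"
    unfolding cpoly_def eq using inj by (simp add: sum.reindex)
  also have "\<dots> = (\<Sum>j<n. of_real (norm (c (e j))))"
  proof (rule sum.cong[OF refl])
    fix j assume "j \<in> {..<n}"
    then have "(\<Prod>i<n. w i ^ e j i) = w j"
      by (simp add: e_def if_distrib[of "\<lambda>x. _ ^ x"] cong: if_cong)
    moreover have "c (e j) * w j = of_real (norm (c (e j)))"
      by (simp add: w_def sgn_eq complex_norm_square[symmetric] power2_eq_square)
    ultimately show "c (e j) * (\<Prod>i<n. w i ^ e j i) = of_real (norm (c (e j)))" by simp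
  qed
  also have "norm \<dots> = (\<Sum>j<n. norm (c (e j)))"
    unfolding of_real_sum[symmetric] norm_of_real by (simp add: sum_nonneg)
  finally have "(\<Sum>j<n. norm (c (e j))) \<le> M"
    using P[rule_format, of w] by (simp add: w_def norm_sgn)
  moreover from this have "M \<ge> 0" by (meson norm_ge_zero order_trans sum_nonneg)
  ultimately show "(\<Sum>\<alpha>\<in>indices_eq 1 n. norm (c \<alpha>) powr (2 * real 1 / (real 1 + 1))) \<le> (1 * M) powr (2 * real 1 / (real 1 + 1))"
    unfolding eq using inj by (simp add: sum.reindex)
qed

text \<open>All blocks have size 1. The constant is exponential in m, but it is applied only to
  block sizes, which are at most 2k for fixed k.\<close>

lemma complex_BH_crude:
  assumes "m > 0"
  shows "complex_BH m (2 ^ m * exp 1 * real m)"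
proof (rule complex_BH_step[where T = "{..<m}" and k = "\<lambda>_. 1" and C = "\<lambda>_. 1"])
  show "{..<m} \<noteq> {}" using assms by blast
qed (simp_all add: complex_BH_1[simplified] powr_realpow)

text \<open>There are m div k blocks of size k, and block 0 absorbs the remainder m mod k, so all
  sizes lie between k and 2k. For fixed k only the factor 2^(m/k) is exponential in m.\<close>

lemma complex_BH_subexponential:
  assumes k: "k > 0" "k \<le> m"
  shows "complex_BH m (2 powr (real m / real k) * (4 ^ k * exp 1 * (2 * real k) * exp 1 * real m ^ (2 * k)))"
proof -
  define \<kappa> where "\<kappa> t = (if t = 0 then k + m mod k else k)" for t :: nat
  have q: "m div k > 0" using k by (simp add: div_greater_zero_iff)
  have "(\<Sum>t<m div k. \<kappa> t) = (\<Sum>t<m div k. k + (if t = 0 then m mod k else 0))"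
    by (intro sum.cong) (auto simp: \<kappa>_def)
  also have "\<dots> = m" unfolding sum.distrib using q by (simp add: sum.delta)
  finally have m: "m = (\<Sum>t<m div k. \<kappa> t)" ..
  have "m mod k < k" using k by simp
  then have \<kappa>: "k \<le> \<kappa> t" "\<kappa> t \<le> 2 * k" for t
    by (auto simp: \<kappa>_def)
  show ?thesis
  proof (rule complex_BH_step[OF finite_lessThan _ _ m])
    show "{..<m div k} \<noteq> {}" using q by blast
    show "0 < \<kappa> t" for t using \<kappa>(1)[of t] k by linarith
    then show "complex_BH (\<kappa> t) (2 ^ \<kappa> t * exp 1 * real (\<kappa> t))" for t
      by (rule complex_BH_crude)
    show "2 powr (real m / real (\<kappa> t)) * (2 ^ \<kappa> t * exp 1 * real (\<kappa> t) * exp 1 * real m ^ \<kappa> t)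
      \<le> 2 powr (real m / real k) * (4 ^ k * exp 1 * (2 * real k) * exp 1 * real m ^ (2 * k))" for t
    proof (intro mult_mono powr_mono power_increasing)
      show "(2::real) ^ \<kappa> t \<le> 4 ^ k"
        using power_increasing[of "\<kappa> t" "2 * k" "2::real"] \<kappa>(2)[of t] by (simp add: power_mult)
      show "real m / real (\<kappa> t) \<le> real m / real k"
        using \<kappa>(1)[of t] k by (intro divide_left_mono) auto
      show "real (\<kappa> t) \<le> 2 * real k" using \<kappa>(2)[of t] by linarith
      show "\<kappa> t \<le> 2 * k" by (rule \<kappa>(2))
    qed (use k in auto)
  qed simp
qed

section \<open>Complexification\<close>

lemma max_modulus_unit_disc:
  assumes "f holomorphic_on UNIV" "\<And>w. norm w = 1 \<Longrightarrow> norm (f w) \<le> B" "norm w \<le> 1"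
  shows "norm (f w) \<le> B"
proof (rule maximum_modulus_frontier[of f "cball 0 1"])
  show "f holomorphic_on interior (cball 0 1)"
    using assms(1) by (rule holomorphic_on_subset) simp
  show "continuous_on (closure (cball 0 1)) f"
    using assms(1) holomorphic_on_imp_continuous_on holomorphic_on_subset by blast
qed (use assms in \<open>auto simp: frontier_cball\<close>)

text \<open>The sum of the moduli of the coefficients bounds the polynomial on the cube, so the real
  supremum is meaningful. Values of x from n on do not matter, so x need not be extensional.\<close>

lemma abs_mpoly_eval_le_SUP:
  assumes \<Lambda>: "finite \<Lambda>" and x: "\<And>i. i < n \<Longrightarrow> \<bar>x i\<bar> \<le> 1"
  shows "\<bar>mpoly_eval n \<Lambda> a x\<bar> \<le> (SUP x\<in>cube n. \<bar>mpoly_eval n \<Lambda> a x\<bar>)"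
proof -
  have "\<bar>mpoly_eval n \<Lambda> a y\<bar> \<le> (\<Sum>\<alpha>\<in>\<Lambda>. \<bar>a \<alpha>\<bar>)" if y: "y \<in> cube n" for y
  proof -
    have "\<bar>a \<alpha> * (\<Prod>i<n. y i ^ \<alpha> i)\<bar> \<le> \<bar>a \<alpha>\<bar>" for \<alpha>
    proof -
      have "\<bar>y i\<bar> \<le> 1" if "i < n" for i using y that by (force simp: cube_def abs_le_iff)
      then have "(\<Prod>i<n. \<bar>y i\<bar> ^ \<alpha> i) \<le> 1"
        by (intro prod_le_1) (auto intro: power_le_one)
      then show ?thesis
        by (simp add: abs_mult abs_prod power_abs mult_left_le)
    qed
    then show ?thesis unfolding mpoly_eval_def by (intro order_trans[OF sum_abs] sum_mono)
  qed
  then have "bdd_above ((\<lambda>x. \<bar>mpoly_eval n \<Lambda> a x\<bar>) ` cube n)" by (rule bdd_aboveI2)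
  moreover have "restrict x {..<n} \<in> cube n"
    using x by (auto simp: cube_def abs_le_iff)
  moreover have "mpoly_eval n \<Lambda> a (restrict x {..<n}) = mpoly_eval n \<Lambda> a x"
    by (simp add: mpoly_eval_def)
  ultimately show ?thesis by (metis (no_types, lifting) cSUP_upper)
qed

text \<open>For \<open>\<bar>w\<bar> = 1\<close> the point \<open>(u + w\<^sup>2 cnj u) / 2\<close> is \<open>w\<close> times a point of the real cube. The values
  \<open>w = 0\<close> and \<open>w = 1 / (1 + sqrt 2)\<close> yield the constants of the homogeneous and the general case.\<close>

lemma interpolating_function_bound:
  fixes a :: "(nat \<Rightarrow> nat) \<Rightarrow> real"
  assumes \<Lambda>: "\<Lambda> \<subseteq> indices_le d n" and u: "\<And>i. i < n \<Longrightarrow> norm (u i) \<le> 1" and w: "norm w \<le> 1"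
    and M: "\<And>x. (\<And>i. i < n \<Longrightarrow> \<bar>x i\<bar> \<le> 1) \<Longrightarrow> \<bar>mpoly_eval n \<Lambda> a x\<bar> \<le> M"
  shows "norm (\<Sum>\<alpha>\<in>\<Lambda>. of_real (a \<alpha>) * w ^ (d - mdegree n \<alpha>) * (\<Prod>i<n. ((u i + w\<^sup>2 * cnj (u i)) / 2) ^ \<alpha> i)) \<le> M"
    (is "norm (?h w) \<le> M")
proof (rule max_modulus_unit_disc[of ?h, OF _ _ w])
  show "?h holomorphic_on UNIV" by (intro holomorphic_intros) auto
  fix w :: complex assume w: "norm w = 1"
  define x where "x i = Re (w * cnj (u i))" for i
  have x: "(u i + w\<^sup>2 * cnj (u i)) / 2 = w * of_real (x i)" for i
  proof -
    have "of_real (x i) = (w * cnj (u i) + cnj (w * cnj (u i))) / 2"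
      unfolding x_def by (simp only: complex_add_cnj) simp
    then have "w * of_real (x i) = (w * cnj w * u i + w\<^sup>2 * cnj (u i)) / 2"
      by (simp add: algebra_simps power2_eq_square)
    moreover have "w * cnj w = 1" using w by (simp flip: complex_norm_square)
    ultimately show ?thesis by simp
  qed
  \<comment> \<open>The power \<open>w ^ (d - mdegree n \<alpha>)\<close> completes every term to
    degree d in w, so that a common unimodular factor splits off.\<close>
  have "?h w = (\<Sum>\<alpha>\<in>\<Lambda>. w ^ d * of_real (a \<alpha> * (\<Prod>i<n. x i ^ \<alpha> i)))"
  proof (rule sum.cong[OF refl])
    fix \<alpha> assume "\<alpha> \<in> \<Lambda>"
    then have "mdegree n \<alpha> \<le> d" using \<Lambda> by (auto simp: indices_le_def)
    then have "w ^ d = w ^ (d - mdegree n \<alpha>) * (\<Prod>i<n. w ^ \<alpha> i)"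
      by (simp add: mdegree_def flip: power_sum power_add)
    then show "of_real (a \<alpha>) * w ^ (d - mdegree n \<alpha>) * (\<Prod>i<n. ((u i + w\<^sup>2 * cnj (u i)) / 2) ^ \<alpha> i)
        = w ^ d * of_real (a \<alpha> * (\<Prod>i<n. x i ^ \<alpha> i))"
      unfolding x by (simp add: power_mult_distrib prod.distrib)
  qed
  also have "\<dots> = w ^ d * of_real (mpoly_eval n \<Lambda> a x)"
    by (simp add: mpoly_eval_def sum_distrib_left)
  finally have "norm (?h w) = \<bar>mpoly_eval n \<Lambda> a x\<bar>"
    using w by (simp add: norm_mult norm_power)
  also have "\<dots> \<le> M"
  proof (rule M)
    fix i assume "i < n"
    then show "\<bar>x i\<bar> \<le> 1"
      using abs_Re_le_cmod[of "w * cnj (u i)"] u[of i] w by (simp add: x_def norm_mult)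
  qed
  finally show "norm (?h w) \<le> M" .
qed

text \<open>At w = 0 the interpolating function is the value at z/2, and homogeneity turns the
  halving into 2^d.\<close>

lemma complexification_homogeneous:
  fixes a :: "(nat \<Rightarrow> nat) \<Rightarrow> real"
  assumes M: "\<And>x. (\<And>i. i < n \<Longrightarrow> \<bar>x i\<bar> \<le> 1) \<Longrightarrow> \<bar>mpoly_eval n (indices_eq d n) a x\<bar> \<le> M"
    and z: "\<And>i. i < n \<Longrightarrow> norm (z i) \<le> 1"
  shows "norm (cpoly n (indices_eq d n) (\<lambda>\<alpha>. of_real (a \<alpha>)) z) \<le> 2 ^ d * M"
proof -
  let ?P = "cpoly n (indices_eq d n) (\<lambda>\<alpha>. of_real (a \<alpha>)) z"
  have "(\<Sum>\<alpha>\<in>indices_eq d n. of_real (a \<alpha>) * 0 ^ (d - mdegree n \<alpha>) * (\<Prod>i<n. ((z i + 0\<^sup>2 * cnj (z i)) / 2) ^ \<alpha> i))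
      = cpoly n (indices_eq d n) (\<lambda>\<alpha>. of_real (a \<alpha>)) (\<lambda>i. 1 / 2 * z i)"
    unfolding cpoly_def by (intro sum.cong refl) (simp add: indices_eq_def)
  also have "\<dots> = (1 / 2) ^ d * ?P" by (rule cpoly_scale)
  finally have "norm ((1 / 2) ^ d * ?P) \<le> M"
    using interpolating_function_bound[where u = z and w = 0, OF indices_eq_subset_le z _ M] by simp
  then show ?thesis by (simp add: norm_mult norm_power norm_divide power_divide field_simps)
qed

text \<open>At w = \<sigma> the points (u + \<sigma>^2 cnj u)/2 with u in the disc fill an ellipse
  that contains the disc of radius \<sigma>. The completing powers of w combine with the scaling to
  a common factor \<sigma>^d.\<close>

lemma complexification_general:
  fixes a :: "(nat \<Rightarrow> nat) \<Rightarrow> real"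
  assumes M: "\<And>x. (\<And>i. i < n \<Longrightarrow> \<bar>x i\<bar> \<le> 1) \<Longrightarrow> \<bar>mpoly_eval n (indices_le d n) a x\<bar> \<le> M"
    and z: "\<And>i. i < n \<Longrightarrow> norm (z i) \<le> 1"
  shows "norm (cpoly n (indices_le d n) (\<lambda>\<alpha>. of_real (a \<alpha>)) z) \<le> (1 + sqrt 2) ^ d * M"
proof -
  let ?P = "cpoly n (indices_le d n) (\<lambda>\<alpha>. of_real (a \<alpha>)) z"
  \<comment> \<open>The inverse of 1 + sqrt 2 and the positive root of \<sigma>^2 + 2 \<sigma> = 1,
    so the imaginary semi-axis (1 - \<sigma>^2)/2 of the ellipse is exactly \<sigma>.\<close>
  define \<sigma> where "\<sigma> = sqrt 2 - 1"
  have \<sigma>: "\<sigma> > 0" "\<sigma> \<le> 1" "(1 + sqrt 2) * \<sigma> = 1"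
    using real_sqrt_le_mono[of 2 4] by (auto simp: \<sigma>_def algebra_simps)
  \<comment> \<open>The solution of (u + \<sigma>^2 cnj u)/2 = \<sigma> z; shrinking the real part
    keeps it in the disc.\<close>
  define u where "u i = Complex (Re (z i) / sqrt 2) (Im (z i))" for i
  have u: "norm (u i) \<le> 1" if "i < n" for i
  proof -
    have "(Re (z i))\<^sup>2 + (Im (z i))\<^sup>2 \<le> 1" using z[OF that] by (simp add: cmod_def)
    then have "(Re (z i))\<^sup>2 / 2 + (Im (z i))\<^sup>2 \<le> 1"
      using zero_le_power2[of "Re (z i)"] by linarith
    then show ?thesis by (simp add: u_def cmod_def power_divide)
  qed
  have z_eq: "(u i + (of_real \<sigma>)\<^sup>2 * cnj (u i)) / 2 = of_real \<sigma> * z i" for i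
  proof (rule complex_eqI)
    have "1 + \<sigma>\<^sup>2 = 2 * sqrt 2 * \<sigma>" "1 - \<sigma>\<^sup>2 = 2 * \<sigma>"
      by (simp_all add: \<sigma>_def power2_eq_square algebra_simps)
    then have "Re (z i) * (1 + \<sigma>\<^sup>2) = Re (z i) * (2 * sqrt 2 * \<sigma>)" "Im (z i) * (1 - \<sigma>\<^sup>2) = Im (z i) * (2 * \<sigma>)"
      by simp_all
    then show "Re ((u i + (of_real \<sigma>)\<^sup>2 * cnj (u i)) / 2) = Re (of_real \<sigma> * z i)"
      "Im ((u i + (of_real \<sigma>)\<^sup>2 * cnj (u i)) / 2) = Im (of_real \<sigma> * z i)"
      by (simp_all add: u_def field_simps flip: of_real_power)
  qed
  have "(\<Sum>\<alpha>\<in>indices_le d n. of_real (a \<alpha>) * of_real \<sigma> ^ (d - mdegree n \<alpha>) *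
      (\<Prod>i<n. ((u i + (of_real \<sigma>)\<^sup>2 * cnj (u i)) / 2) ^ \<alpha> i)) = of_real \<sigma> ^ d * ?P"
    unfolding cpoly_def sum_distrib_left
  proof (rule sum.cong[OF refl])
    fix \<alpha> assume "\<alpha> \<in> indices_le d n"
    then have "complex_of_real \<sigma> ^ d = of_real \<sigma> ^ (d - mdegree n \<alpha>) * (\<Prod>i<n. of_real \<sigma> ^ \<alpha> i)"
      by (simp add: indices_le_def mdegree_def flip: power_sum power_add)
    then show "of_real (a \<alpha>) * of_real \<sigma> ^ (d - mdegree n \<alpha>) * (\<Prod>i<n. ((u i + (of_real \<sigma>)\<^sup>2 * cnj (u i)) / 2) ^ \<alpha> i)
        = of_real \<sigma> ^ d * (of_real (a \<alpha>) * (\<Prod>i<n. z i ^ \<alpha> i))"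
      unfolding z_eq by (simp add: power_mult_distrib prod.distrib)
  qed
  then have "norm (of_real \<sigma> ^ d * ?P) \<le> M"
    using interpolating_function_bound[where u = u and w = "of_real \<sigma>", OF order_refl u _ M] \<sigma> by simp
  then have "(1 + sqrt 2) ^ d * (\<sigma> ^ d * norm ?P) \<le> (1 + sqrt 2) ^ d * M"
    using \<sigma> by (intro mult_left_mono) (auto simp: norm_mult norm_power)
  then show ?thesis using \<sigma>(3) by (simp flip: mult.assoc power_mult_distrib)
qed

section \<open>Homogenization by one additional variable\<close>

text \<open>The variable with index n fills up the degree to d; resetting its exponent to 0 is the
  inverse map.\<close>

lemma sum_homogenize:
  "(\<Sum>\<beta>\<in>indices_eq d (Suc n). f \<beta>) = (\<Sum>\<alpha>\<in>indices_le d n. f (\<alpha>(n := d - mdegree n \<alpha>)))"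
proof (rule sum.reindex_bij_witness[where i = "\<lambda>\<alpha>. \<alpha>(n := d - mdegree n \<alpha>)" and j = "\<lambda>\<beta>. \<beta>(n := 0)"])
  have upd: "mdegree n (\<alpha>(n := j)) = mdegree n \<alpha>" for \<alpha> j
    by (simp add: mdegree_def)
  show eq: "(\<beta>(n := 0))(n := d - mdegree n (\<beta>(n := 0))) = \<beta>" if "\<beta> \<in> indices_eq d (Suc n)" for \<beta>
    using that by (auto simp: upd indices_eq_def mdegree_def)
  show "\<beta>(n := 0) \<in> indices_le d n" if "\<beta> \<in> indices_eq d (Suc n)" for \<beta>
    using that by (auto simp: upd indices_eq_def indices_le_def multi_indices_def mdegree_def)
  show "(\<alpha>(n := d - mdegree n \<alpha>))(n := 0) = \<alpha>" if "\<alpha> \<in> indices_le d n" for \<alpha>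
    using that by (auto simp: indices_le_def multi_indices_def)
  show "\<alpha>(n := d - mdegree n \<alpha>) \<in> indices_eq d (Suc n)" if "\<alpha> \<in> indices_le d n" for \<alpha>
    using that by (auto simp: indices_eq_def indices_le_def multi_indices_def mdegree_def)
  show "f ((\<beta>(n := 0))(n := d - mdegree n (\<beta>(n := 0)))) = f \<beta>" if "\<beta> \<in> indices_eq d (Suc n)" for \<beta>
    using eq[OF that] by simp
qed

lemma cpoly_homogenize:
  "cpoly (Suc n) (indices_eq d (Suc n)) c z
    = (\<Sum>\<alpha>\<in>indices_le d n. c (\<alpha>(n := d - mdegree n \<alpha>)) * z n ^ (d - mdegree n \<alpha>) * (\<Prod>i<n. z i ^ \<alpha> i))"
  unfolding cpoly_def sum_homogenize by (intro sum.cong refl) (simp add: mult_ac)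

text \<open>By the maximum principle in the last variable w it suffices to take w unimodular. There
  the homogenization is w^d times the polynomial at z/w, again a point of the polydisc, so
  homogenizing costs nothing.\<close>

lemma complexification_homogenized:
  fixes a :: "(nat \<Rightarrow> nat) \<Rightarrow> real"
  assumes M: "\<And>x. (\<And>i. i < n \<Longrightarrow> \<bar>x i\<bar> \<le> 1) \<Longrightarrow> \<bar>mpoly_eval n (indices_le d n) a x\<bar> \<le> M"
    and z: "\<And>i. i < Suc n \<Longrightarrow> norm (z i) \<le> 1"
  shows "norm (cpoly (Suc n) (indices_eq d (Suc n)) (\<lambda>\<beta>. of_real (a (\<beta>(n := 0)))) z) \<le> (1 + sqrt 2) ^ d * M"
proof -
  define F where "F w = (\<Sum>\<alpha>\<in>indices_le d n. complex_of_real (a \<alpha>) * w ^ (d - mdegree n \<alpha>) * (\<Prod>i<n. z i ^ \<alpha> i))" for w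
  have "norm (F (z n)) \<le> (1 + sqrt 2) ^ d * M"
  proof (rule max_modulus_unit_disc[of F])
    show "F holomorphic_on UNIV" unfolding F_def by (intro holomorphic_intros)
    fix w :: complex assume w: "norm w = 1"
    then have w0: "w \<noteq> 0" by auto
    have "F w = (\<Sum>\<alpha>\<in>indices_le d n. w ^ d * (of_real (a \<alpha>) * (\<Prod>i<n. (z i / w) ^ \<alpha> i)))"
      unfolding F_def
    proof (rule sum.cong[OF refl])
      fix \<alpha> assume "\<alpha> \<in> indices_le d n"
      then have "w ^ d = w ^ (d - mdegree n \<alpha>) * (\<Prod>i<n. w ^ \<alpha> i)"
        by (simp add: indices_le_def mdegree_def flip: power_sum power_add)
      moreover have "(\<Prod>i<n. z i ^ \<alpha> i) = (\<Prod>i<n. w ^ \<alpha> i) * (\<Prod>i<n. (z i / w) ^ \<alpha> i)"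
        using w0 by (simp add: power_divide flip: prod.distrib)
      ultimately show "of_real (a \<alpha>) * w ^ (d - mdegree n \<alpha>) * (\<Prod>i<n. z i ^ \<alpha> i)
          = w ^ d * (of_real (a \<alpha>) * (\<Prod>i<n. (z i / w) ^ \<alpha> i))" by (simp only: mult_ac)
    qed
    then have "F w = w ^ d * cpoly n (indices_le d n) (\<lambda>\<alpha>. of_real (a \<alpha>)) (\<lambda>i. z i / w)"
      by (simp add: cpoly_def sum_distrib_left)
    moreover have "norm (cpoly n (indices_le d n) (\<lambda>\<alpha>. of_real (a \<alpha>)) (\<lambda>i. z i / w)) \<le> (1 + sqrt 2) ^ d * M"
      using M z w by (intro complexification_general) (auto simp: norm_divide)
    ultimately show "norm (F w) \<le> (1 + sqrt 2) ^ d * M" using w by (simp add: norm_mult norm_power)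
  qed (use z in auto)
  also have "F (z n) = cpoly (Suc n) (indices_eq d (Suc n)) (\<lambda>\<beta>. of_real (a (\<beta>(n := 0)))) z"
    unfolding F_def cpoly_homogenize
    by (intro sum.cong refl) (auto simp: indices_le_def multi_indices_def fun_upd_idem)
  finally show ?thesis .
qed

section \<open>Upper bounds for the real constants\<close>

lemma powr_root_le:
  fixes S X :: real
  assumes "d > 0" "X \<ge> 0" "S \<ge> 0" "S \<le> X powr (2 * real d / (real d + 1))"
  shows "S powr ((real d + 1) / (2 * real d)) \<le> X"
proof -
  have "S powr ((real d + 1) / (2 * real d))
      \<le> (X powr (2 * real d / (real d + 1))) powr ((real d + 1) / (2 * real d))"
    using assms by (intro powr_mono2) auto
  also have "\<dots> = X powr 1"
  proof -
    have "real d + 1 \<noteq> 0" by linarith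
    then show ?thesis unfolding powr_powr using assms(1) by simp
  qed
  finally show ?thesis using assms by simp
qed

lemma BH_hom_le:
  assumes "d > 0" "C \<ge> 1" "complex_BH d C"
  shows "BH_hom d \<le> ereal (C * 2 ^ d)"
  unfolding BH_hom_def
proof (rule Inf_lower, rule CollectI, rule exI[of _ "C * 2 ^ d"], intro conjI refl)
  show "1 \<le> C * 2 ^ d"
    using mult_mono[of 1 C 1 "2 ^ d"] assms by simp
  show "BH_inequality d (indices_eq d) (C * 2 ^ d)"
    unfolding BH_inequality_def
  proof (intro allI impI)
    fix n and a :: "(nat \<Rightarrow> nat) \<Rightarrow> real"
    define M where "M = (SUP x\<in>cube n. \<bar>mpoly_eval n (indices_eq d n) a x\<bar>)"
    have M: "\<bar>mpoly_eval n (indices_eq d n) a x\<bar> \<le> M" if "\<And>i. i < n \<Longrightarrow> \<bar>x i\<bar> \<le> 1" for x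
      unfolding M_def using that by (intro abs_mpoly_eval_le_SUP finite_indices_eq)
    have M0: "M \<ge> 0" using M[of "\<lambda>_. 0"] by (smt (verit) abs_ge_zero)
    have "norm (cpoly n (indices_eq d n) (\<lambda>\<alpha>. of_real (a \<alpha>)) z) \<le> 2 ^ d * M" if "\<forall>i<n. norm (z i) \<le> 1" for z
      using that M by (intro complexification_homogeneous) auto
    then have "(\<Sum>\<alpha>\<in>indices_eq d n. norm (complex_of_real (a \<alpha>)) powr (2 * real d / (real d + 1)))
        \<le> (C * (2 ^ d * M)) powr (2 * real d / (real d + 1))"
      using assms(3) unfolding complex_BH_def by blast
    then show "(\<Sum>\<alpha>\<in>indices_eq d n. \<bar>a \<alpha>\<bar> powr (2 * real d / (real d + 1))) powr ((real d + 1) / (2 * real d))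
        \<le> C * 2 ^ d * (SUP x\<in>cube n. \<bar>mpoly_eval n (indices_eq d n) a x\<bar>)"
      unfolding M_def[symmetric] using assms M0
      by (intro powr_root_le) (auto simp: mult_ac sum_nonneg)
  qed
qed

text \<open>The homogenized polynomial has the same coefficients, so the inequality for forms in n +
  1 variables gives the one for polynomials in n variables.\<close>

lemma BH_le_le:
  assumes "d > 0" "C \<ge> 1" "complex_BH d C"
  shows "BH_le d \<le> ereal (C * (1 + sqrt 2) ^ d)"
  unfolding BH_le_def
proof (rule Inf_lower, rule CollectI, rule exI[of _ "C * (1 + sqrt 2) ^ d"], intro conjI refl)
  show "1 \<le> C * (1 + sqrt 2) ^ d"
    using mult_mono[of 1 C 1 "(1 + sqrt 2) ^ d"] assms by (simp add: one_le_power)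
  show "BH_inequality d (indices_le d) (C * (1 + sqrt 2) ^ d)"
    unfolding BH_inequality_def
  proof (intro allI impI)
    fix n and a :: "(nat \<Rightarrow> nat) \<Rightarrow> real"
    define M where "M = (SUP x\<in>cube n. \<bar>mpoly_eval n (indices_le d n) a x\<bar>)"
    have M: "\<bar>mpoly_eval n (indices_le d n) a x\<bar> \<le> M" if "\<And>i. i < n \<Longrightarrow> \<bar>x i\<bar> \<le> 1" for x
      unfolding M_def using that by (intro abs_mpoly_eval_le_SUP finite_indices_le)
    have M0: "M \<ge> 0" using M[of "\<lambda>_. 0"] by (smt (verit) abs_ge_zero)
    have "norm (cpoly (Suc n) (indices_eq d (Suc n)) (\<lambda>\<beta>. of_real (a (\<beta>(n := 0)))) z) \<le> (1 + sqrt 2) ^ d * M"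
      if "\<forall>i<Suc n. norm (z i) \<le> 1" for z
      using that M by (intro complexification_homogenized) auto
    then have "(\<Sum>\<beta>\<in>indices_eq d (Suc n). norm (complex_of_real (a (\<beta>(n := 0)))) powr (2 * real d / (real d + 1)))
        \<le> (C * ((1 + sqrt 2) ^ d * M)) powr (2 * real d / (real d + 1))"
      using assms(3) unfolding complex_BH_def by blast
    also have "(\<Sum>\<beta>\<in>indices_eq d (Suc n). norm (complex_of_real (a (\<beta>(n := 0)))) powr (2 * real d / (real d + 1)))
        = (\<Sum>\<alpha>\<in>indices_le d n. \<bar>a \<alpha>\<bar> powr (2 * real d / (real d + 1)))"
      unfolding sum_homogenize
      by (intro sum.cong refl) (auto simp: indices_le_def multi_indices_def fun_upd_idem)
    finally show "(\<Sum>\<alpha>\<in>indices_le d n. \<bar>a \<alpha>\<bar> powr (2 * real d / (real d + 1))) powr ((real d + 1) / (2 * real d))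
        \<le> C * (1 + sqrt 2) ^ d * (SUP x\<in>cube n. \<bar>mpoly_eval n (indices_le d n) a x\<bar>)"
      unfolding M_def[symmetric] using assms M0
      by (intro powr_root_le) (auto simp: mult_ac sum_nonneg)
  qed
qed

section \<open>Lower bounds\<close>

text \<open>Forms are treated as functions, so the test polynomials can be given by recursions
  without computing coefficients.\<close>

definition real_form :: "nat \<Rightarrow> nat \<Rightarrow> ((nat \<Rightarrow> complex) \<Rightarrow> complex) \<Rightarrow> bool" where
  "real_form n d f \<longleftrightarrow> (\<exists>a :: (nat \<Rightarrow> nat) \<Rightarrow> real. \<forall>z. f z = cpoly n (indices_eq d n) (\<lambda>\<alpha>. of_real (a \<alpha>)) z)"

lemma real_form_mult:
  assumes "real_form n d f" "real_form n e g"
  shows "real_form n (d + e) (\<lambda>z. f z * g z)"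
proof -
  obtain a b where ab: "\<And>z. f z = cpoly n (indices_eq d n) (\<lambda>\<alpha>. of_real (a \<alpha>)) z"
    "\<And>z. g z = cpoly n (indices_eq e n) (\<lambda>\<alpha>. of_real (b \<alpha>)) z"
    using assms unfolding real_form_def by metis
  have "conv n d e (\<lambda>\<alpha>. complex_of_real (a \<alpha>)) (\<lambda>\<alpha>. of_real (b \<alpha>)) = (\<lambda>\<gamma>. of_real (conv n d e a b \<gamma>))"
    by (simp add: conv_def fun_eq_iff)
  then show ?thesis
    unfolding real_form_def ab cpoly_mult by metis
qed

lemma real_form_lincomb:
  assumes "real_form n d f" "real_form n d g"
  shows "real_form n d (\<lambda>z. of_real s * f z + of_real t * g z)"
proof -
  obtain a b where ab: "\<And>z. f z = cpoly n (indices_eq d n) (\<lambda>\<alpha>. of_real (a \<alpha>)) z"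
    "\<And>z. g z = cpoly n (indices_eq d n) (\<lambda>\<alpha>. of_real (b \<alpha>)) z"
    using assms unfolding real_form_def by metis
  show ?thesis
    unfolding real_form_def ab
    by (intro exI[of _ "\<lambda>\<alpha>. s * a \<alpha> + t * b \<alpha>"])
      (simp add: cpoly_def sum_distrib_left sum.distrib algebra_simps)
qed

lemma real_form_diff:
  "real_form n d f \<Longrightarrow> real_form n d g \<Longrightarrow> real_form n d (\<lambda>z. f z - g z)"
  using real_form_lincomb[of n d f g 1 "-1"] by simp

lemma real_form_one: "real_form n 0 (\<lambda>z. 1)"
proof -
  have "indices_eq 0 n = {\<lambda>_. 0}"
  proof (intro equalityI subsetI)
    fix \<alpha> assume "\<alpha> \<in> indices_eq 0 n"
    then have "\<alpha> = (\<lambda>_. 0)"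
      by (intro multi_indices_eqI[of _ n]) (auto simp: indices_eq_def multi_indices_def mdegree_def)
    then show "\<alpha> \<in> {\<lambda>_. 0}" by simp
  qed (auto simp: indices_eq_def multi_indices_def mdegree_def)
  then show ?thesis
    unfolding real_form_def by (intro exI[of _ "\<lambda>_. 1"]) (simp add: cpoly_def)
qed

lemma real_form_var:
  assumes "s < n"
  shows "real_form n 1 (\<lambda>z. z s)"
proof -
  define e where "e = (\<lambda>i. if i = s then 1 else 0 :: nat)"
  have e: "e \<in> indices_eq 1 n"
    using assms by (auto simp: e_def indices_eq_def multi_indices_def mdegree_def)
  have "(\<Prod>i<n. z i ^ e i) = z s" for z :: "nat \<Rightarrow> complex"
    using assms by (simp add: e_def if_distrib[of "\<lambda>x. _ ^ x"] cong: if_cong)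
  then show ?thesis
    unfolding real_form_def using e
    by (intro exI[of _ "\<lambda>\<alpha>. if \<alpha> = e then 1 else 0"])
      (simp add: cpoly_def finite_indices_eq if_distrib[of complex_of_real] mult_delta_left sum.delta cong: if_cong)
qed

lemma real_form_power: "real_form n d f \<Longrightarrow> real_form n (d * N) (\<lambda>z. f z ^ N)"
proof (induction N)
  case (Suc N)
  then show ?case using real_form_mult[of n d f "d * N" "\<lambda>z. f z ^ N"] by simp
qed (simp add: real_form_one)

lemma cpoly_of_real:
  "cpoly n \<Lambda> (\<lambda>\<alpha>. of_real (a \<alpha>)) (\<lambda>i. of_real (x i)) = of_real (mpoly_eval n \<Lambda> a x)"
  by (simp add: cpoly_def mpoly_eval_def)

text \<open>If the polynomial is at most 1 on the cube, the inequality bounds every single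
  coefficient by C. The triangle inequality then bounds any value on the polydisc.\<close>

lemma BH_inequality_lower_bound:
  assumes BH: "BH_inequality d \<Lambda> C" and "d > 0" "n \<ge> 1" "C \<ge> 0" and fin: "finite (\<Lambda> n)"
    and le: "\<And>x. x \<in> cube n \<Longrightarrow> \<bar>mpoly_eval n (\<Lambda> n) a x\<bar> \<le> 1"
    and z: "\<And>i. i < n \<Longrightarrow> norm (z i) \<le> 1"
  shows "norm (cpoly n (\<Lambda> n) (\<lambda>\<alpha>. of_real (a \<alpha>)) z) \<le> real (card (\<Lambda> n)) * C"
proof -
  define p where "p = 2 * real d / (real d + 1)"
  have p: "p > 0" "(real d + 1) / (2 * real d) = 1 / p"
    using \<open>d > 0\<close> by (auto simp: p_def)
  have "(\<lambda>i\<in>{..<n}. 0) \<in> cube n" by (auto simp: cube_def)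
  then have "cube n \<noteq> {}" by blast
  then have sup: "(SUP x\<in>cube n. \<bar>mpoly_eval n (\<Lambda> n) a x\<bar>) \<le> 1"
    using le by (intro cSUP_least)
  have coeff: "\<bar>a \<alpha>\<bar> \<le> C" if "\<alpha> \<in> \<Lambda> n" for \<alpha>
  proof -
    have "\<bar>a \<alpha>\<bar> = (\<bar>a \<alpha>\<bar> powr p) powr (1 / p)" using p by (simp add: powr_powr)
    also have "\<dots> \<le> (\<Sum>\<alpha>\<in>\<Lambda> n. \<bar>a \<alpha>\<bar> powr p) powr (1 / p)"
      using p that fin by (intro powr_mono2 member_le_sum) auto
    also have "\<dots> \<le> C * (SUP x\<in>cube n. \<bar>mpoly_eval n (\<Lambda> n) a x\<bar>)"
      using BH \<open>n \<ge> 1\<close> unfolding BH_inequality_def p(2) p_def[symmetric] by blast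
    also have "\<dots> \<le> C * 1" using sup \<open>C \<ge> 0\<close> by (intro mult_left_mono)
    finally show ?thesis by simp
  qed
  have "norm (cpoly n (\<Lambda> n) (\<lambda>\<alpha>. of_real (a \<alpha>)) z) \<le> (\<Sum>\<alpha>\<in>\<Lambda> n. C)"
    unfolding cpoly_def
  proof (intro order_trans[OF norm_sum] sum_mono)
    fix \<alpha> assume "\<alpha> \<in> \<Lambda> n"
    have "(\<Prod>i<n. norm (z i) ^ \<alpha> i) \<le> 1" using z by (intro prod_le_1) (auto intro: power_le_one)
    then have "\<bar>a \<alpha>\<bar> * (\<Prod>i<n. norm (z i) ^ \<alpha> i) \<le> C * 1"
      using coeff[OF \<open>\<alpha> \<in> \<Lambda> n\<close>] \<open>C \<ge> 0\<close> by (intro mult_mono) (auto intro: prod_nonneg)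
    then show "norm (complex_of_real (a \<alpha>) * (\<Prod>i<n. z i ^ \<alpha> i)) \<le> C"
      by (simp add: norm_mult norm_power flip: prod_norm)
  qed
  then show ?thesis by simp
qed

lemma cube_abs_le: "x \<in> cube n \<Longrightarrow> i < n \<Longrightarrow> \<bar>x i\<bar> \<le> 1"
  by (force simp: cube_def abs_le_iff)

lemma divide_card_le:
  fixes C V :: real
  assumes "V \<le> real c * C" "c \<le> (d + 1) ^ n" "C \<ge> 0"
  shows "V / (real d + 1) ^ n \<le> C"
proof -
  have "real c \<le> (real d + 1) ^ n"
    using of_nat_mono[OF assms(2), where ?'a = real] by (simp add: add.commute)
  then have "V \<le> (real d + 1) ^ n * C"
    using assms mult_right_mono[of "real c" "(real d + 1) ^ n" C] by linarith
  then show ?thesis by (simp add: divide_le_eq mult.commute add_pos_nonneg)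
qed

lemma BH_hom_ge:
  assumes "d > 0" "n \<ge> 1" and f: "real_form n d f"
    and le: "\<And>x. (\<And>i. \<bar>x i\<bar> \<le> 1) \<Longrightarrow> norm (f (\<lambda>i. of_real (x i))) \<le> 1"
    and z: "\<And>i. i < n \<Longrightarrow> norm (z i) \<le> 1"
  shows "BH_hom d \<ge> ereal (norm (f z) / (real d + 1) ^ n)"
  unfolding BH_hom_def
proof (rule Inf_greatest, clarify)
  fix C :: real assume C: "C \<ge> 1" "BH_inequality d (indices_eq d) C"
  obtain a where a: "\<And>z. f z = cpoly n (indices_eq d n) (\<lambda>\<alpha>. of_real (a \<alpha>)) z"
    using f unfolding real_form_def by metis
  have "norm (f z) \<le> real (card (indices_eq d n)) * C"
    unfolding a
  proof (rule BH_inequality_lower_bound[where d = d and \<Lambda> = "indices_eq d"])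
    fix x assume x: "x \<in> cube n"
    \<comment> \<open>Points of \<open>cube n\<close> are undefined from n on, while
      \<open>le\<close> asks for a bound at all indices.\<close>
    define y where "y i = (if i < n then x i else 0)" for i
    have "norm (f (\<lambda>i. of_real (y i))) \<le> 1"
      using cube_abs_le[OF x] by (intro le) (auto simp: y_def)
    moreover have "mpoly_eval n (indices_eq d n) a y = mpoly_eval n (indices_eq d n) a x"
      by (simp add: mpoly_eval_def y_def)
    ultimately show "\<bar>mpoly_eval n (indices_eq d n) a x\<bar> \<le> 1"
      unfolding a cpoly_of_real by simp
  qed (use C assms finite_indices_eq in auto)
  then show "ereal (norm (f z) / (real d + 1) ^ n) \<le> ereal C"
    using divide_card_le[OF _ card_indices_eq] C by simp
qed

lemma BH_le_ge:
  assumes "d > 0" "n \<ge> 1" and f: "real_form (Suc n) d f"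
    and le: "\<And>x. (\<And>i. \<bar>x i\<bar> \<le> 1) \<Longrightarrow> x n = 1 \<Longrightarrow> norm (f (\<lambda>i. of_real (x i))) \<le> 1"
    and z: "\<And>i. i < n \<Longrightarrow> norm (z i) \<le> 1" "z n = 1"
  shows "BH_le d \<ge> ereal (norm (f z) / (real d + 1) ^ n)"
  unfolding BH_le_def
proof (rule Inf_greatest, clarify)
  fix C :: real assume C: "C \<ge> 1" "BH_inequality d (indices_le d) C"
  obtain b where b: "\<And>z. f z = cpoly (Suc n) (indices_eq d (Suc n)) (\<lambda>\<alpha>. of_real (b \<alpha>)) z"
    using f unfolding real_form_def by metis
  \<comment> \<open>The coefficients of the dehomogenization obtained by setting variable n to
    1.\<close>
  define a where "a \<alpha> = b (\<alpha>(n := d - mdegree n \<alpha>))" for \<alpha>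
  have fa: "f z = cpoly n (indices_le d n) (\<lambda>\<alpha>. of_real (a \<alpha>)) z" if "z n = 1" for z
    unfolding b cpoly_homogenize by (simp add: cpoly_def a_def that)
  have "norm (f z) \<le> real (card (indices_le d n)) * C"
    unfolding fa[where z = z, OF z(2)]
  proof (rule BH_inequality_lower_bound[where d = d and \<Lambda> = "indices_le d"])
    fix x assume x: "x \<in> cube n"
    define y where "y i = (if i < n then x i else 1)" for i
    have "norm (f (\<lambda>i. of_real (y i))) \<le> 1"
      using cube_abs_le[OF x] by (intro le) (auto simp: y_def)
    moreover have "y n = 1" by (simp add: y_def)
    then have "f (\<lambda>i. of_real (y i)) = of_real (mpoly_eval n (indices_le d n) a y)"
      using fa[of "\<lambda>i. of_real (y i)"] by (simp add: cpoly_of_real)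
    moreover have "mpoly_eval n (indices_le d n) a y = mpoly_eval n (indices_le d n) a x"
      by (simp add: mpoly_eval_def y_def)
    ultimately show "\<bar>mpoly_eval n (indices_le d n) a x\<bar> \<le> 1" by simp
  qed (use C assms finite_indices_le in auto)
  then show "ereal (norm (f z) / (real d + 1) ^ n) \<le> ereal C"
    using divide_card_le[OF _ card_indices_le] C by simp
qed

section \<open>Forms that are small on the real cube and large on the torus\<close>

text \<open>Level j uses the 2^j variables from s on. The two squared forms have disjoint variables,
  so their values can be prescribed independently.\<close>

primrec extremal_form :: "nat \<Rightarrow> nat \<Rightarrow> (nat \<Rightarrow> complex) \<Rightarrow> complex" where
  "extremal_form 0 s z = z s"
| "extremal_form (Suc j) s z = (extremal_form j s z)\<^sup>2 - (extremal_form j (s + 2 ^ j) z)\<^sup>2"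

lemma real_form_extremal_form: "s + 2 ^ j \<le> n \<Longrightarrow> real_form n (2 ^ j) (extremal_form j s)"
proof (induction j arbitrary: s)
  case 0
  then show ?case using real_form_var[of s n] by (simp add: fun_eq_iff[symmetric])
next
  case (Suc j)
  have "real_form n (2 ^ j * 2) (\<lambda>z. (extremal_form j s z)\<^sup>2 - (extremal_form j (s + 2 ^ j) z)\<^sup>2)"
    using Suc.prems by (intro real_form_diff real_form_power Suc.IH) auto
  then show ?case by (simp add: mult.commute)
qed

text \<open>Real squares lie in [0,1], so their difference stays in [-1,1]; over the complex numbers
  the two squares can instead add up.\<close>

lemma extremal_form_real:
  assumes "\<And>i. \<bar>x i\<bar> \<le> 1"
  shows "\<exists>r. \<bar>r\<bar> \<le> 1 \<and> extremal_form j s (\<lambda>i. of_real (x i)) = of_real r"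
proof (induction j arbitrary: s)
  case 0
  then show ?case using assms by auto
next
  case (Suc j)
  obtain r1 r2 where r: "\<bar>r1\<bar> \<le> 1" "\<bar>r2\<bar> \<le> 1"
    "extremal_form j s (\<lambda>i. of_real (x i)) = of_real r1" "extremal_form j (s + 2 ^ j) (\<lambda>i. of_real (x i)) = of_real r2"
    using Suc.IH by metis
  have "0 \<le> r1\<^sup>2" "0 \<le> r2\<^sup>2" "r1\<^sup>2 \<le> 1" "r2\<^sup>2 \<le> 1" using r(1,2) by (auto simp: abs_square_le_1)
  then have "\<bar>r1\<^sup>2 - r2\<^sup>2\<bar> \<le> 1" by linarith
  then show ?case using r by (intro exI[of _ "r1\<^sup>2 - r2\<^sup>2"]) auto
qed

lemma extremal_form_cong:
  "(\<And>i. s \<le> i \<Longrightarrow> i < s + 2 ^ j \<Longrightarrow> z i = w i) \<Longrightarrow> extremal_form j s z = extremal_form j s w"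
proof (induction j arbitrary: s)
  case (Suc j)
  have "extremal_form j s z = extremal_form j s w" "extremal_form j (s + 2 ^ j) z = extremal_form j (s + 2 ^ j) w"
    by (rule Suc.IH, rule Suc.prems, simp_all)+
  then show ?case by simp
qed simp

text \<open>The induction needs every unimodular c: square roots of c and -c are prescribed as
  phases of the two halves, so that the difference of squares doubles. The exponent e of 2 becomes
  2e + 1 at each level, which gives 2^j - 1.\<close>

lemma extremal_form_peak:
  assumes "norm c = 1"
  shows "\<exists>z. (\<forall>i. norm (z i) = 1) \<and> extremal_form j s z = c * 2 ^ (2 ^ j - 1)"
  using assms
proof (induction j arbitrary: s c)
  case 0
  then show ?case by (intro exI[of _ "\<lambda>_. c"]) auto
next
  case (Suc j)
  have norm: "norm (csqrt c) = 1" "norm (csqrt (- c)) = 1" using Suc.prems by (simp_all add: norm_csqrt)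
  obtain z1 where z1: "\<And>i. norm (z1 i) = 1" "extremal_form j s z1 = csqrt c * 2 ^ (2 ^ j - 1)"
    using Suc.IH[OF norm(1)] by metis
  obtain z2 where z2: "\<And>i. norm (z2 i) = 1" "extremal_form j (s + 2 ^ j) z2 = csqrt (- c) * 2 ^ (2 ^ j - 1)"
    using Suc.IH[OF norm(2)] by metis
  define z where "z i = (if i < s + 2 ^ j then z1 i else z2 i)" for i
  have "extremal_form j s z = extremal_form j s z1" "extremal_form j (s + 2 ^ j) z = extremal_form j (s + 2 ^ j) z2"
    by (rule extremal_form_cong, simp add: z_def)+
  then have "extremal_form (Suc j) s z = 2 * c * (2 ^ (2 ^ j - 1))\<^sup>2"
    by (simp add: z1 z2 power_mult_distrib)
  also have "\<dots> = c * 2 ^ (2 ^ Suc j - 1)"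
  proof -
    have "1 + (a - 1) * 2 = 2 * a - 1" if "a \<ge> 1" for a :: nat using that by linarith
    from this[of "2 ^ j"] have "1 + (2 ^ j - 1) * 2 = (2 ^ Suc j - 1 :: nat)" by simp
    then have "(2::complex) ^ (2 ^ Suc j - 1) = 2 ^ (1 + (2 ^ j - 1) * 2)" by simp
    then show ?thesis by (simp add: power_add power_mult)
  qed
  finally have "extremal_form (Suc j) s z = c * 2 ^ (2 ^ Suc j - 1)" .
  moreover have "norm (z i) = 1" for i using z1 z2 by (simp add: z_def)
  ultimately show ?case by blast
qed

text \<open>Passing to the N-th power raises the degree but keeps the number 2^j of variables, so
  for fixed j the denominator is polynomial in the degree.\<close>

lemma BH_hom_lower_bound:
  assumes "N > 0"
  shows "BH_hom (2 ^ j * N) \<ge> ereal (2 ^ ((2 ^ j - 1) * N) / (real (2 ^ j * N) + 1) ^ (2 ^ j))"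
proof -
  obtain z where z: "\<And>i. norm (z i) = 1" "extremal_form j 0 z = 1 * 2 ^ (2 ^ j - 1)"
    using extremal_form_peak[of 1 j 0] by auto
  have "norm ((extremal_form j 0 z) ^ N) = 2 ^ ((2 ^ j - 1) * N)"
    by (simp add: z norm_power power_mult)
  moreover have "ereal (norm ((extremal_form j 0 z) ^ N) / (real (2 ^ j * N) + 1) ^ (2 ^ j)) \<le> BH_hom (2 ^ j * N)"
  proof (rule BH_hom_ge[where f = "\<lambda>z. extremal_form j 0 z ^ N"])
    show "real_form (2 ^ j) (2 ^ j * N) (\<lambda>z. extremal_form j 0 z ^ N)"
      by (intro real_form_power real_form_extremal_form) simp
    show "norm (extremal_form j 0 (\<lambda>i. of_real (x i)) ^ N) \<le> 1" if "\<And>i. \<bar>x i\<bar> \<le> 1" for x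
      using extremal_form_real[where x = x, OF that, of j 0] by (auto simp: norm_power intro!: power_le_one)
  qed (use assms z in auto)
  ultimately show ?thesis by simp
qed

section \<open>Homogenized Chebyshev polynomials\<close>

text \<open>With T_d the Chebyshev polynomial of the first kind, this is \<open>z 1 ^ d\<close>
  times T_d at \<open>z 0 / z 1\<close>, when \<open>z 1\<close> is nonzero.\<close>

fun chebyshev_form :: "nat \<Rightarrow> (nat \<Rightarrow> complex) \<Rightarrow> complex" where
  "chebyshev_form 0 z = 1"
| "chebyshev_form (Suc 0) z = z 0"
| "chebyshev_form (Suc (Suc d)) z = 2 * z 0 * chebyshev_form (Suc d) z - (z 1)\<^sup>2 * chebyshev_form d z"

lemma real_form_chebyshev_form: "real_form 2 d (chebyshev_form d)"
proof (induction d rule: induct_nat_012)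
  case 0
  then show ?case using real_form_one[of 2] by simp
next
  case 1
  then show ?case using real_form_var[of 0 2] by simp
next
  case (ge2 d)
  have "real_form 2 (Suc (Suc d)) (\<lambda>z. z 0 * chebyshev_form (Suc d) z)"
    using real_form_mult[OF real_form_var[of 0 2] ge2(2)] by simp
  moreover have "real_form 2 (Suc (Suc d)) (\<lambda>z. (z 1)\<^sup>2 * chebyshev_form d z)"
    using real_form_mult[OF real_form_power[OF real_form_var[of 1 2], of 2] ge2(1)] by simp
  ultimately show ?case
    using real_form_lincomb[of 2 "Suc (Suc d)" "\<lambda>z. z 0 * chebyshev_form (Suc d) z" "\<lambda>z. (z 1)\<^sup>2 * chebyshev_form d z" 2 "-1"]
    by (simp add: mult.assoc)
qed

lemma chebyshev_form_cos:
  assumes "z 0 = of_real (cos t)" "z 1 = 1"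
  shows "chebyshev_form d z = of_real (cos (real d * t))"
proof (induction d rule: induct_nat_012)
  case (ge2 d)
  have "cos (real (Suc (Suc d)) * t) = 2 * cos t * cos (real (Suc d) * t) - cos (real d * t)"
    using cos_plus_cos[of "real (Suc (Suc d)) * t" "real d * t"]
    by (simp add: algebra_simps add_divide_distrib)
  then show ?case using ge2 assms by simp
qed (use assms in auto)

text \<open>After splitting off the powers of the imaginary unit, the recursion has characteristic
  equation x^2 = 2x + 1, whose roots are 1 + sqrt 2 and 1 - sqrt 2.\<close>

lemma chebyshev_form_at_ii:
  assumes "z 0 = \<i>" "z 1 = 1"
  shows "chebyshev_form d z = \<i> ^ d * of_real (((1 + sqrt 2) ^ d + (1 - sqrt 2) ^ d) / 2)"
proof (induction d rule: induct_nat_012)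
  case (ge2 d)
  have step: "x ^ Suc (Suc d) = 2 * x ^ Suc d + x ^ d" if "x\<^sup>2 = 2 * x + 1" for x :: real
  proof -
    have "x ^ Suc (Suc d) = x\<^sup>2 * x ^ d" by (simp add: power2_eq_square)
    then show ?thesis by (simp add: that algebra_simps)
  qed
  have "(1 + sqrt 2)\<^sup>2 = 2 * (1 + sqrt 2) + 1" "(1 - sqrt 2)\<^sup>2 = 2 * (1 - sqrt 2) + 1"
    by (simp_all add: power2_eq_square algebra_simps)
  note rec = this[THEN step]
  have "2 * \<i> * (\<i> ^ Suc d * of_real ((A1 + B1) / 2)) - 1\<^sup>2 * (\<i> ^ d * of_real ((A0 + B0) / 2))
      = \<i> ^ Suc (Suc d) * of_real ((2 * A1 + A0 + (2 * B1 + B0)) / 2)" for A0 A1 B0 B1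
    by (simp add: field_simps)
  then show ?case
    unfolding chebyshev_form.simps ge2 rec assms .
qed (use assms in auto)

text \<open>One variable suffices: the Chebyshev polynomial is at most 1 on [-1,1], but grows like
  (1 + sqrt 2)^d at the imaginary unit.\<close>

lemma BH_le_lower_bound:
  assumes "d > 0"
  shows "BH_le d \<ge> ereal ((1 + sqrt 2) ^ d / (4 * (real d + 1)))"
proof -
  define z :: "nat \<Rightarrow> complex" where "z i = (if i = 0 then \<i> else 1)" for i
  define U where "U = ((1 + sqrt 2) ^ d + (1 - sqrt 2) ^ d) / 2"
  have "\<bar>1 - sqrt 2\<bar> \<le> 1" using real_sqrt_le_mono[of 2 4] by auto
  then have "\<bar>(1 - sqrt 2) ^ d\<bar> \<le> 1" by (simp add: power_abs power_le_one)
  then have "- 1 \<le> (1 - sqrt 2) ^ d" by linarith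
  moreover have "1 + sqrt 2 \<le> (1 + sqrt 2) ^ d"
    using power_increasing[of 1 d "1 + sqrt 2"] assms by simp
  moreover have "1 \<le> sqrt 2" by simp
  \<comment> \<open>Here A is at least 2 and B at least -1, so A + B is at least A - 1, hence at
    least A/2.\<close>
  moreover have "A / 4 \<le> (A + B) / 2" if "- 1 \<le> B" "1 + s \<le> A" "1 \<le> s" for A B s :: real
    using that by (simp add: field_simps)
  ultimately have U: "(1 + sqrt 2) ^ d / 4 \<le> U" unfolding U_def by blast
  have "ereal (norm (chebyshev_form d z) / (real d + 1) ^ 1) \<le> BH_le d"
  proof (rule BH_le_ge[where n = 1 and f = "chebyshev_form d" and z = z, OF assms])
    show "real_form (Suc 1) d (chebyshev_form d)"
      using real_form_chebyshev_form[of d] by (simp add: numeral_2_eq_2)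
    show "norm (chebyshev_form d (\<lambda>i. of_real (x i))) \<le> 1" if "\<And>i. \<bar>x i\<bar> \<le> 1" "x 1 = 1" for x
    proof -
      have "cos (arccos (x 0)) = x 0" using that(1)[of 0] by (simp add: abs_le_iff)
      then show ?thesis using that by (subst chebyshev_form_cos[of _ "arccos (x 0)"]) auto
    qed
  qed (auto simp: z_def)
  moreover have "norm (chebyshev_form d z) = \<bar>U\<bar>"
  proof -
    have "chebyshev_form d z = \<i> ^ d * of_real U"
      unfolding U_def by (rule chebyshev_form_at_ii) (simp_all add: z_def)
    then show ?thesis by (simp add: norm_mult norm_power)
  qed
  moreover have "(1 + sqrt 2) ^ d / (4 * (real d + 1)) \<le> \<bar>U\<bar> / (real d + 1)"
    using divide_right_mono[of "(1 + sqrt 2) ^ d / 4" "\<bar>U\<bar>" "real d + 1"] U by simp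
  ultimately show ?thesis by (metis ereal_less_eq(3) order_trans power_one_right)
qed

section \<open>Asymptotics\<close>

lemma ereal_root_ge:
  assumes "d > 0" "ereal L \<le> x"
  shows "ereal (root d L) \<le> ereal_root d x"
  using assms by (cases x) (auto simp: ereal_root_def)

text \<open>For x = -\<infinity> the root is that of \<open>real_of_ereal x\<close>, which is 0; the
  sign of U covers this case.\<close>

lemma ereal_root_le:
  assumes "d > 0" "x \<le> ereal U" "U \<ge> 0"
  shows "ereal_root d x \<le> ereal (root d U)"
  using assms by (cases x) (auto simp: ereal_root_def)

lemma root_Suc_tendsto_1: "(\<lambda>d. root d (real d + 1)) \<longlonglongrightarrow> 1"
proof (rule tendsto_sandwich)
  show "\<forall>\<^sub>F d in sequentially. 1 \<le> root d (real d + 1)"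
    using eventually_gt_at_top[of 0] by eventually_elim simp
  show "\<forall>\<^sub>F d in sequentially. root d (real d + 1) \<le> root d 2 * root d (real d)"
    using eventually_gt_at_top[of 0]
    by eventually_elim (simp flip: real_root_mult)
  show "(\<lambda>d. root d 2 * root d (real d)) \<longlonglongrightarrow> 1"
    using tendsto_mult[OF LIMSEQ_root_const[of 2] LIMSEQ_root] by simp
qed simp

lemma root_upper_tendsto:
  assumes "A > 0" "K \<ge> 0"
  shows "(\<lambda>d. root d (2 powr (real d / real k) * (A * real d ^ p) * K ^ d)) \<longlonglongrightarrow> 2 powr (1 / real k) * K"
proof (rule Lim_transform_eventually)
  show "(\<lambda>d. 2 powr (1 / real k) * (root d A * root d (real d) ^ p) * K) \<longlonglongrightarrow> 2 powr (1 / real k) * K"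
    using tendsto_mult[OF tendsto_mult[OF tendsto_const[of "2 powr (1 / real k)"]
          tendsto_mult[OF LIMSEQ_root_const[OF assms(1)] tendsto_power[OF LIMSEQ_root, of p]]] tendsto_const[of K]]
    by simp
  show "\<forall>\<^sub>F d in sequentially. 2 powr (1 / real k) * (root d A * root d (real d) ^ p) * K
      = root d (2 powr (real d / real k) * (A * real d ^ p) * K ^ d)"
    using eventually_gt_at_top[of 0]
  proof eventually_elim
    case (elim d)
    have "2 powr (real d / real k) = (2 powr (1 / real k)) ^ d"
      by (simp add: powr_power)
    then show ?case using elim assms by (simp add: real_root_mult real_root_power real_root_power_cancel)
  qed
qed

lemma root_lower_tendsto:
  assumes "b \<ge> 0" "c > 0"
  shows "(\<lambda>d. root d (b ^ d / (c * (real d + 1) ^ p))) \<longlonglongrightarrow> b"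
proof (rule Lim_transform_eventually)
  show "(\<lambda>d. b / (root d c * root d (real d + 1) ^ p)) \<longlonglongrightarrow> b"
    using tendsto_divide[OF tendsto_const[of b]
        tendsto_mult[OF LIMSEQ_root_const[OF assms(2)] tendsto_power[OF root_Suc_tendsto_1, of p]]]
    by simp
  show "\<forall>\<^sub>F d in sequentially. b / (root d c * root d (real d + 1) ^ p) = root d (b ^ d / (c * (real d + 1) ^ p))"
    using eventually_gt_at_top[of 0]
    by eventually_elim (use assms in \<open>simp add: real_root_mult real_root_divide real_root_power real_root_power_cancel\<close>)
qed

text \<open>For fixed k the d-th roots of the bounds tend to 2^(1/k) K, since A and p do not depend
  on d. Then k tends to infinity.\<close>

lemma limsup_ereal_root_le:
  assumes "K \<ge> 0"
    and bound: "\<And>k. k > 0 \<Longrightarrow> \<exists>A>0. \<exists>p. \<forall>d\<ge>k. x d \<le> ereal (2 powr (real d / real k) * (A * real d ^ p) * K ^ d)"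
  shows "limsup (\<lambda>d. ereal_root d (x d)) \<le> ereal K"
proof (rule LIMSEQ_le_const)
  have "(\<lambda>k. 2 powr (1 / real (Suc k)) * K) \<longlonglongrightarrow> 2 powr 0 * K"
    by (intro tendsto_intros LIMSEQ_Suc[OF lim_1_over_n]) auto
  then show "(\<lambda>k. ereal (2 powr (1 / real (Suc k)) * K)) \<longlonglongrightarrow> ereal K" by simp
  have "limsup (\<lambda>d. ereal_root d (x d)) \<le> ereal (2 powr (1 / real (Suc k)) * K)" for k
  proof -
    obtain A p where A: "A > 0" and
      x: "\<And>d. d \<ge> Suc k \<Longrightarrow> x d \<le> ereal (2 powr (real d / real (Suc k)) * (A * real d ^ p) * K ^ d)"
      using bound[of "Suc k"] by auto
    let ?U = "\<lambda>d. 2 powr (real d / real (Suc k)) * (A * real d ^ p) * K ^ d"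
    have "limsup (\<lambda>d. ereal_root d (x d)) \<le> limsup (\<lambda>d. ereal (root d (?U d)))"
    proof (rule Limsup_mono)
      show "\<forall>\<^sub>F d in sequentially. ereal_root d (x d) \<le> ereal (root d (?U d))"
        using eventually_ge_at_top[of "Suc k"]
      proof eventually_elim
        case (elim d)
        show ?case using elim A assms(1) by (intro ereal_root_le x mult_nonneg_nonneg) auto
      qed
    qed
    also have "\<dots> = ereal (2 powr (1 / real (Suc k)) * K)"
      using root_upper_tendsto[OF A assms(1), of "Suc k" p] by (intro lim_imp_Limsup) auto
    finally show ?thesis .
  qed
  then show "\<exists>N. \<forall>k\<ge>N. limsup (\<lambda>d. ereal_root d (x d)) \<le> ereal (2 powr (1 / real (Suc k)) * K)" by blast
qed

text \<open>A lower bound along a subsequence of degrees is enough for a limes superior, and the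
  d-th root of the polynomial denominator tends to 1.\<close>

lemma limsup_ereal_root_ge:
  fixes r :: "nat \<Rightarrow> nat"
  assumes "strict_mono r" "b \<ge> 0" "c > 0"
    and x: "\<And>N. N > 0 \<Longrightarrow> ereal (b ^ r N / (c * (real (r N) + 1) ^ p)) \<le> x (r N)"
  shows "ereal b \<le> limsup (\<lambda>d. ereal_root d (x d))"
proof -
  let ?L = "\<lambda>d. root d (b ^ d / (c * (real d + 1) ^ p))"
  have "(\<lambda>N. ?L (r N)) \<longlonglongrightarrow> b"
    using LIMSEQ_subseq_LIMSEQ[OF root_lower_tendsto[OF assms(2,3), of p] assms(1)] by (simp add: o_def)
  then have "ereal b = limsup (\<lambda>N. ereal (?L (r N)))"
    by (intro lim_imp_Limsup[symmetric]) auto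
  also have "\<dots> \<le> limsup (\<lambda>N. ereal_root (r N) (x (r N)))"
  proof (rule Limsup_mono)
    show "\<forall>\<^sub>F N in sequentially. ereal (?L (r N)) \<le> ereal_root (r N) (x (r N))"
      using eventually_gt_at_top[of 0]
    proof eventually_elim
      case (elim N)
      then have "r N > 0" using strict_mono_less[OF assms(1), of 0 N] by linarith
      then show ?case using elim by (intro ereal_root_ge x)
    qed
  qed
  also have "\<dots> \<le> limsup (\<lambda>d. ereal_root d (x d))"
    using limsup_subseq_mono[OF assms(1), of "\<lambda>d. ereal_root d (x d)"] by (simp add: o_def)
  finally show ?thesis .
qed

text \<open>The bound is also shown to be at least 1, because the Bohnenblust--Hille constants only
  admit such C.\<close>

lemma complex_BH_subexponential_ex:
  assumes "k > 0"
  shows "\<exists>A>0. \<exists>p. \<forall>d\<ge>k. 1 \<le> 2 powr (real d / real k) * (A * real d ^ p) \<and>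
    complex_BH d (2 powr (real d / real k) * (A * real d ^ p))"
proof (intro exI conjI allI impI)
  let ?A = "4 ^ k * exp 1 * (2 * real k) * exp 1"
  show "?A > 0" using assms by simp
  fix d assume d: "d \<ge> k"
  show "complex_BH d (2 powr (real d / real k) * (?A * real d ^ (2 * k)))"
    using complex_BH_subexponential[OF assms d] by (simp add: mult.assoc)
  have "1 * (1 * 1 * (1 * 1) * 1 * 1) \<le> 2 powr (real d / real k) * (?A * real d ^ (2 * k))"
    using assms d by (intro mult_mono one_le_power ge_one_powr_ge_zero) auto
  then show "1 \<le> 2 powr (real d / real k) * (?A * real d ^ (2 * k))" by simp
qed

lemma limsup_BH_hom_le: "limsup (\<lambda>d. ereal_root d (BH_hom d)) \<le> ereal 2"
proof (rule limsup_ereal_root_le)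
  fix k :: nat assume "k > 0"
  then show "\<exists>A>0. \<exists>p. \<forall>d\<ge>k. BH_hom d \<le> ereal (2 powr (real d / real k) * (A * real d ^ p) * 2 ^ d)"
    using complex_BH_subexponential_ex[of k] BH_hom_le by (meson less_le_trans)
qed simp

lemma limsup_BH_le_le: "limsup (\<lambda>d. ereal_root d (BH_le d)) \<le> ereal (1 + sqrt 2)"
proof (rule limsup_ereal_root_le)
  fix k :: nat assume "k > 0"
  then show "\<exists>A>0. \<exists>p. \<forall>d\<ge>k. BH_le d \<le> ereal (2 powr (real d / real k) * (A * real d ^ p) * (1 + sqrt 2) ^ d)"
    using complex_BH_subexponential_ex[of k] BH_le_le by (meson less_le_trans)
qed simp

text \<open>For fixed j the degrees 2^j N give the lower bound 2^(1 - 2^(-j)); then j tends to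
  infinity.\<close>

lemma limsup_BH_hom_ge: "ereal 2 \<le> limsup (\<lambda>d. ereal_root d (BH_hom d))"
proof (rule LIMSEQ_le_const2)
  have "(\<lambda>j. 2 powr (1 - (1 / 2) ^ j)) \<longlonglongrightarrow> 2 powr (1 - 0 :: real)"
    by (intro tendsto_intros LIMSEQ_power_zero) auto
  then show "(\<lambda>j. ereal (2 powr (1 - (1 / 2) ^ j))) \<longlonglongrightarrow> ereal 2" by simp
  have "ereal (2 powr (1 - (1 / 2) ^ j)) \<le> limsup (\<lambda>d. ereal_root d (BH_hom d))" for j
  proof (rule limsup_ereal_root_ge[where r = "\<lambda>N. 2 ^ j * N" and c = 1 and p = "2 ^ j"])
    fix N :: nat assume N: "N > 0"
    \<comment> \<open>The peak value is rewritten as a fixed base raised to the degree.\<close>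
    have "(2 powr (1 - (1 / 2) ^ j)) ^ (2 ^ j * N) = 2 powr ((1 - (1 / 2) ^ j) * real (2 ^ j * N))"
      by (simp add: powr_power mult.commute)
    also have "(1 - (1 / 2) ^ j) * real (2 ^ j * N) = real ((2 ^ j - 1) * N)"
      by (simp add: of_nat_diff field_simps power_divide)
    also have "2 powr real ((2 ^ j - 1) * N) = (2::real) ^ ((2 ^ j - 1) * N)"
      by (rule powr_realpow) simp
    finally have "(2 powr (1 - (1 / 2) ^ j)) ^ (2 ^ j * N) = (2::real) ^ ((2 ^ j - 1) * N)" .
    then show "ereal ((2 powr (1 - (1 / 2) ^ j)) ^ (2 ^ j * N) / (1 * (real (2 ^ j * N) + 1) ^ 2 ^ j))
        \<le> BH_hom (2 ^ j * N)"
      using BH_hom_lower_bound[OF N, of j] by simp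
  qed (auto simp: strict_mono_def)
  then show "\<exists>N. \<forall>j\<ge>N. ereal (2 powr (1 - (1 / 2) ^ j)) \<le> limsup (\<lambda>d. ereal_root d (BH_hom d))" by blast
qed

lemma limsup_BH_le_ge: "ereal (1 + sqrt 2) \<le> limsup (\<lambda>d. ereal_root d (BH_le d))"
proof (rule limsup_ereal_root_ge[where r = "\<lambda>d. d" and c = 4 and p = 1])
  fix d :: nat assume "d > 0"
  then show "ereal ((1 + sqrt 2) ^ d / (4 * (real d + 1) ^ 1)) \<le> BH_le d"
    using BH_le_lower_bound[of d] by simp
qed (auto simp: strict_mono_def)

theorem proposition1p2:
  shows "limsup (\<lambda>d. ereal_root d (BH_hom d)) = ereal 2 \<and>
         limsup (\<lambda>d. ereal_root d (BH_le d)) = ereal (1 + sqrt 2)"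
  using limsup_BH_hom_le limsup_BH_hom_ge limsup_BH_le_le limsup_BH_le_ge
  by (intro conjI order.antisym)

end
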